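(* Let $\alpha>0$. In the white noise sequence model with the truncated Gaussian prior $\Pi_n$ described in the context, if $k\sim n^{1/(2\alpha+1)}$ and $$\min\{\sigma_{i,k}^2i^{2\alpha}:1\le i\le k\}\sim k^{-1},$$ then the posterior converges (relative to the $\ell_2$-norm) at the rate $\varepsilon_n=n^{-\alpha/(2\alpha+1)}$ for any $\theta_0=(\theta_{0,1},\theta_{0,2},\dots)$ such that $\sum_{i=1}^\infty\theta_{0,i}^2i^{2\alpha}<\infty$.
   Context: White noise sequence model: the observation $X^{(n)}=(X_1,X_2,\dots)$ is an infinite sequence of independent random variables, $X_i$ being normally distributed with mean $\theta_i$ and variance $n^{-1}$, where $\theta=(\theta_1,\theta_2,\dots)\in\ell_2$; its law is $P_\theta^{(n)}$. $\|\theta\|^2=\sum_i\theta_i^2$. Prior $\Pi_n$: for a cutoff $k=k_n\in\mathbb{N}$, $\theta_1,\dots,\theta_k$ are independent with $\theta_i\sim N(0,\sigma_{i,k}^2)$ and $\theta_{k+1}=\theta_{k+2}=\cdots=0$. Here $(\sigma_{i,k}^2)_{1\le i\le k}$ is a triangular array of positive variances. $a\sim b$ means that $a$ and $b$ are of the same order (ratio bounded away from $0$ and $\infty$). "The posterior converges at the rate $\varepsilon_n$" means: $P_{\theta_0}^{(n)}\Pi_n(\theta:\|\theta-\theta_0\|\ge M_n\varepsilon_n\mid X^{(n)})\to0$ for every $M_n\to\infty$, where $\Pi_n(\cdot\mid X^{(n)})$ is the posterior distribution and $Pf=\int f\,dP$. *)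

theory Defs
  imports "HOL-Probability.Probability" "HOL-Library.Landau_Symbols"
begin

text \<open>Sequences \<open>(x\<^sub>1, x\<^sub>2, \<dots>)\<close> are functions on \<open>{1..}\<close>; the value at index \<open>0\<close> is irrelevant.\<close>

definition seq_space :: "(nat \<Rightarrow> real) measure" where
  "seq_space = (\<Pi>\<^sub>M i\<in>{1..}. borel)"

definition ell2 :: "(nat \<Rightarrow> real) set" where
  "ell2 = {\<theta>. (\<lambda>i. (\<theta> i)\<^sup>2) summable_on {1..}}"

definition ell2_norm :: "(nat \<Rightarrow> real) \<Rightarrow> real" where
  "ell2_norm \<theta> = sqrt (\<Sum>\<^sub>\<infinity>i\<in>{1..}. (\<theta> i)\<^sup>2)"

text \<open>Note that \<open>normal_density\<close> takes the standard deviation, not the variance.\<close>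

definition white_noise :: "nat \<Rightarrow> (nat \<Rightarrow> real) \<Rightarrow> (nat \<Rightarrow> real) measure" where
  "white_noise n \<theta> =
     (\<Pi>\<^sub>M i\<in>{1..}. density lborel (normal_density (\<theta> i) (1 / sqrt (real n))))"

text \<open>
  The parameter space is \<open>ell2\<close> with the trace of the product sigma-algebra, which is the
  Borel sigma-algebra of the \<open>ell2\<close>-norm. The product measure below gives \<open>ell2\<close> full mass, so the
  restriction is again a probability measure. The argument \<open>s\<close> consists of standard deviations.
\<close>

definition truncated_gaussian_prior :: "nat \<Rightarrow> (nat \<Rightarrow> real) \<Rightarrow> (nat \<Rightarrow> real) measure" where
  "truncated_gaussian_prior k s =
     restrict_space
       (\<Pi>\<^sub>M i\<in>{1..}. if i \<le> k then density lborel (normal_density 0 (s i)) else return borel 0)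
       ell2"

text \<open>
  A posterior distribution is a (version of the) regular conditional distribution of the parameter
  given the observation, under the joint law in which the parameter has law \<open>\<mu>\<close> and the observation,
  a random element of \<open>X\<close>, has conditional law \<open>P \<theta>\<close>. The measure \<open>\<mu> \<bind> P\<close> is the marginal law of
  the observation.
\<close>

definition is_posterior ::
  "'t measure \<Rightarrow> ('t \<Rightarrow> 'x measure) \<Rightarrow> 'x measure \<Rightarrow> ('x \<Rightarrow> 't measure) \<Rightarrow> bool" where
  "is_posterior \<mu> P X K \<longleftrightarrow>
     K \<in> X \<rightarrow>\<^sub>M prob_algebra \<mu> \<and>
     (\<forall>A\<in>sets X. \<forall>B\<in>sets \<mu>.
        (\<integral>\<^sup>+\<theta>\<in>B. emeasure (P \<theta>) A \<partial>\<mu>) = (\<integral>\<^sup>+x\<in>A. emeasure (K x) B \<partial>(\<mu> \<bind> P)))"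

definition posterior_converges_at_rate ::
  "(nat \<Rightarrow> (nat \<Rightarrow> real) \<Rightarrow> (nat \<Rightarrow> real) measure) \<Rightarrow> (nat \<Rightarrow> real) \<Rightarrow> (nat \<Rightarrow> real) \<Rightarrow> bool" where
  "posterior_converges_at_rate K \<theta>\<^sub>0 \<epsilon> \<longleftrightarrow>
     (\<forall>M :: nat \<Rightarrow> real. filterlim M at_top sequentially \<longrightarrow>
        (\<lambda>n. \<integral>x. measure (K n x)
               {\<theta> \<in> space (K n x). ell2_norm (\<lambda>i. \<theta> i - \<theta>\<^sub>0 i) \<ge> M n * \<epsilon> n}
             \<partial>white_noise n \<theta>\<^sub>0) \<longlonglongrightarrow> 0)"

end

theory Submission
  imports Defs
begin

text \<open>
  The prior is a product of centred Gaussians, hence conjugate: given the observation, the coordinates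
  \<open>i \<le> k\<close> of the parameter are independent normal with mean \<open>c\<^sub>i x\<^sub>i\<close>, where
  \<open>c\<^sub>i = n \<sigma>\<^sub>i\<^sup>2 / (1 + n \<sigma>\<^sub>i\<^sup>2)\<close>, and variance \<open>c\<^sub>i / n\<close>. Markov's inequality for the squared distance
  bounds the expected posterior mass far from \<open>\<theta>\<^sub>0\<close> by a sum of posterior variances, variances of the posterior
  mean (each at most \<open>1 / n\<close>), squared biases \<open>(1 - c\<^sub>i)\<^sup>2 \<theta>\<^sub>0\<^sub>i\<^sup>2 \<le> \<theta>\<^sub>0\<^sub>i\<^sup>2 / (n \<sigma>\<^sub>i\<^sup>2)\<close> and the tail of
  \<open>\<theta>\<^sub>0\<close> beyond \<open>k\<close>; each part is of order \<open>n\<close> to the power \<open>-2\<alpha> / (2\<alpha> + 1)\<close>.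

  An arbitrary version of the posterior agrees with the conjugate one only up to null sets of the marginal law
  of the observation, equivalently of the law with parameter \<open>0\<close>. These are null for the law with
  parameter \<open>\<theta>\<^sub>0\<close> since \<open>\<theta>\<^sub>0\<close> is square summable.
\<close>

subsection \<open>Densities and null sets of product measures\<close>

lemma nn_integral_PiM_prod:
  fixes M :: "'i \<Rightarrow> 'a measure" and f :: "'i \<Rightarrow> 'a \<Rightarrow> ennreal"
  assumes M: "\<And>i. i \<in> I \<Longrightarrow> prob_space (M i)"
    and J: "finite J" "J \<subseteq> I"
    and f: "\<And>i. i \<in> J \<Longrightarrow> f i \<in> borel_measurable (M i)"
  shows "(\<integral>\<^sup>+x. (\<Prod>i\<in>J. f i (x i)) \<partial>PiM I M) = (\<Prod>i\<in>J. \<integral>\<^sup>+y. f i y \<partial>M i)"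
proof -
  define N where "N i = (if i \<in> J then M i else count_space {undefined})" for i
  have N: "prob_space (N i)" for i
  proof (cases "i \<in> J")
    case True
    then have "i \<in> I" using J by auto
    then show ?thesis using M[of i] True by (simp add: N_def)
  next
    case False
    then show ?thesis by (auto simp: N_def intro!: prob_spaceI)
  qed
  interpret product_sigma_finite N
    unfolding product_sigma_finite_def by (intro allI prob_space_imp_sigma_finite N)
  have eq: "PiM J M = PiM J N"
    by (intro PiM_cong) (auto simp: N_def)
  have m: "(\<lambda>x. \<Prod>i\<in>J. f i (x i)) \<in> borel_measurable (PiM J M)"
    using f by (intro borel_measurable_prod_ennreal measurable_compose[OF measurable_component_singleton]) auto
  have "(\<integral>\<^sup>+x. (\<Prod>i\<in>J. f i (x i)) \<partial>PiM I M) = (\<integral>\<^sup>+x. (\<Prod>i\<in>J. f i ((\<lambda>i\<in>J. x i) i)) \<partial>PiM I M)"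
    by (intro nn_integral_cong prod.cong) auto
  also have "\<dots> = (\<integral>\<^sup>+x. (\<Prod>i\<in>J. f i (x i)) \<partial>distr (PiM I M) (PiM J M) (\<lambda>x. \<lambda>i\<in>J. x i))"
    using J m by (subst nn_integral_distr) (auto intro!: measurable_restrict_subset)
  also have "\<dots> = (\<integral>\<^sup>+x. (\<Prod>i\<in>J. f i (x i)) \<partial>PiM J M)"
    using distr_PiM_reindex[of I M "\<lambda>x. x" J] M J by (simp add: subset_eq Pi_def)
  also have "\<dots> = (\<Prod>i\<in>J. \<integral>\<^sup>+y. f i y \<partial>M i)"
    unfolding eq using f J by (subst product_nn_integral_prod) (auto simp: N_def)
  finally show ?thesis .
qed

lemma nn_integral_PiM_component:
  assumes M: "\<And>i. i \<in> I \<Longrightarrow> prob_space (M i)" and "i \<in> I"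
    and f: "f \<in> borel_measurable (M i)"
  shows "(\<integral>\<^sup>+x. f (x i) \<partial>PiM I M) = (\<integral>\<^sup>+y. f y \<partial>M i)"
  using nn_integral_PiM_prod[of I M "{i}" "\<lambda>_. f"] assms by simp

lemma PiM_density_finite:
  fixes M :: "'i \<Rightarrow> 'a measure" and f :: "'i \<Rightarrow> 'a \<Rightarrow> ennreal"
  assumes M: "\<And>i. i \<in> I \<Longrightarrow> prob_space (M i)"
    and N: "\<And>i. i \<in> I \<Longrightarrow> prob_space (N i)"
    and J: "finite J" "J \<subseteq> I"
    and f: "\<And>i. i \<in> J \<Longrightarrow> f i \<in> borel_measurable (M i)"
    and dens: "\<And>i. i \<in> J \<Longrightarrow> N i = density (M i) (f i)"
    and same: "\<And>i. i \<in> I - J \<Longrightarrow> N i = M i"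
  shows "PiM I N = density (PiM I M) (\<lambda>x. \<Prod>i\<in>J. f i (x i))"
proof (rule measure_eqI_PiM_infinite)
  show "sets (PiM I N) = PiM I N" ..
  have s: "sets (N i) = sets (M i)" if "i \<in> I" for i
    using dens[of i] same[of i] that by (cases "i \<in> J") auto
  have sp: "space (N i) = space (M i)" if "i \<in> I" for i
    using s[OF that] by (rule sets_eq_imp_space_eq)
  show "sets (density (PiM I M) (\<lambda>x. \<Prod>i\<in>J. f i (x i))) = PiM I N"
    by (simp add: s cong: sets_PiM_cong)
  show "finite_measure (PiM I N)"
    using prob_space_PiM[of I N] N by (simp add: prob_space_def)
  fix A K assume K: "finite K" "K \<subseteq> I" and A: "\<And>i. i \<in> K \<Longrightarrow> A i \<in> sets (N i)"
  have A': "A i \<in> sets (M i)" if "i \<in> K" for i using A[OF that] s K that by auto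
  define g where "g i x = (if i \<in> J then f i x else 1) * (if i \<in> K then indicator (A i) x else 1)" for i x
  have gm: "g i \<in> borel_measurable (M i)" for i
  proof -
    have "(\<lambda>x. if i \<in> J then f i x else 1) \<in> borel_measurable (M i)"
      using f[of i] by (cases "i \<in> J") simp_all
    moreover have "(\<lambda>x. if i \<in> K then indicator (A i) x else 1 :: ennreal) \<in> borel_measurable (M i)"
      using A'[of i] by (cases "i \<in> K") simp_all
    ultimately show ?thesis
      unfolding g_def by (rule borel_measurable_times_ennreal)
  qed
  have fJ: "(\<lambda>x. \<Prod>i\<in>J. f i (x i)) \<in> borel_measurable (PiM I M)"
    using f J by (intro borel_measurable_prod_ennreal measurable_compose[OF measurable_component_singleton]) auto
  have emb: "prod_emb I N K (Pi\<^sub>E K A) = prod_emb I M K (Pi\<^sub>E K A)"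
    using sp by (auto simp: prod_emb_def PiE_iff)
  have mem: "prod_emb I M K (Pi\<^sub>E K A) \<in> sets (PiM I M)"
    using K A' by (intro sets_PiM_I) auto
  have "emeasure (density (PiM I M) (\<lambda>x. \<Prod>i\<in>J. f i (x i))) (prod_emb I N K (Pi\<^sub>E K A)) =
     (\<integral>\<^sup>+x. (\<Prod>i\<in>J. f i (x i)) * indicator (prod_emb I M K (Pi\<^sub>E K A)) x \<partial>PiM I M)"
    unfolding emb by (rule emeasure_density[OF fJ mem])
  also have "\<dots> = (\<integral>\<^sup>+x. (\<Prod>i\<in>J \<union> K. g i (x i)) \<partial>PiM I M)"
  proof (intro nn_integral_cong)
    fix x assume x: "x \<in> space (PiM I M)"
    have "(\<Prod>i\<in>J \<union> K. g i (x i)) = (\<Prod>i\<in>J \<union> K. if i \<in> J then f i (x i) else 1) *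
        (\<Prod>i\<in>J \<union> K. if i \<in> K then indicator (A i) (x i) else 1)"
      by (simp add: g_def prod.distrib)
    also have "(\<Prod>i\<in>J \<union> K. if i \<in> J then f i (x i) else 1) = (\<Prod>i\<in>J. f i (x i))"
      using J K by (intro prod.mono_neutral_cong_right) auto
    also have "(\<Prod>i\<in>J \<union> K. if i \<in> K then indicator (A i) (x i) else 1) = (\<Prod>i\<in>K. indicator (A i) (x i) :: ennreal)"
      using J K by (intro prod.mono_neutral_cong_right) auto
    also have "\<dots> = indicator (prod_emb I M K (Pi\<^sub>E K A)) x"
    proof (cases "\<forall>i\<in>K. x i \<in> A i")
      case True
      then show ?thesis using x by (auto simp: prod_emb_def space_PiM PiE_iff)
    next
      case False
      then have "(\<Prod>i\<in>K. indicator (A i) (x i) :: ennreal) = 0"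
        using K by (intro prod_zero) (auto simp: indicator_def)
      moreover have "x \<notin> prod_emb I M K (Pi\<^sub>E K A)" using False by (auto simp: prod_emb_def PiE_iff)
      ultimately show ?thesis by simp
    qed
    finally show "(\<Prod>i\<in>J. f i (x i)) * indicator (prod_emb I M K (Pi\<^sub>E K A)) x = (\<Prod>i\<in>J \<union> K. g i (x i))"
      by simp
  qed
  also have "\<dots> = (\<Prod>i\<in>J \<union> K. \<integral>\<^sup>+y. g i y \<partial>M i)"
    using M J K gm by (intro nn_integral_PiM_prod) auto
  also have "\<dots> = (\<Prod>i\<in>J \<union> K. if i \<in> K then emeasure (N i) (A i) else 1)"
  proof (intro prod.cong refl)
    fix i assume i: "i \<in> J \<union> K"
    then have iI: "i \<in> I" using J K by auto
    show "(\<integral>\<^sup>+y. g i y \<partial>M i) = (if i \<in> K then emeasure (N i) (A i) else 1)"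
    proof (cases "i \<in> J")
      case True
      have "(\<integral>\<^sup>+y. f i y \<partial>M i) = emeasure (N i) (space (N i))"
        using f[OF True] by (simp add: dens[OF True] emeasure_density cong: nn_integral_cong)
      also have "\<dots> = 1" using N[OF iI] by (rule prob_space.emeasure_space_1)
      finally show ?thesis
        using True f[OF True] A' by (auto simp: g_def dens[OF True] emeasure_density)
    next
      case False
      then show ?thesis using i iI A' same[of i] by (auto simp: g_def)
    qed
  qed
  also have "\<dots> = (\<Prod>i\<in>K. emeasure (N i) (A i))"
    using J K by (intro prod.mono_neutral_cong_right) auto
  also have "\<dots> = emeasure (PiM I N) (prod_emb I N K (Pi\<^sub>E K A))"
    using emeasure_PiM_emb[of I N K A] N K A by auto
  finally show "emeasure (PiM I N) (prod_emb I N K (Pi\<^sub>E K A)) =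
    emeasure (density (PiM I M) (\<lambda>x. \<Prod>i\<in>J. f i (x i))) (prod_emb I N K (Pi\<^sub>E K A))" ..
qed

lemma symdiff_approximation:
  fixes F :: "nat \<Rightarrow> 'a set set"
  assumes P: "finite_measure P" and Q: "finite_measure Q" and PQ: "sets Q = sets P"
    and F: "\<And>m. sigma_algebra (space P) (F m)" and mono: "incseq F"
    and gen: "sets P = sigma_sets (space P) (\<Union>m. F m)"
    and A: "A \<in> sets P" and \<epsilon>: "\<epsilon> > 0"
  shows "\<exists>B\<in>(\<Union>m. F m). measure P (sym_diff A B) + measure Q (sym_diff A B) < \<epsilon>"
proof -
  interpret P: finite_measure P by fact
  interpret Q: finite_measure Q by fact
  define d where "d A B = measure P (sym_diff A B) + measure Q (sym_diff A B)" for A B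
  define G where "G = (\<Union>m. F m)"
  have spQ: "space Q = space P" using PQ by (rule sets_eq_imp_space_eq)
  have GP: "B \<in> sets P" if "B \<in> G" for B using that unfolding gen G_def by auto
  have GQ: "B \<in> sets Q" if "B \<in> G" for B using GP[OF that] PQ by simp
  have tri: "d A C \<le> d A B + d B C" if "A \<in> sets P" "B \<in> sets P" "C \<in> sets P" for A B C
  proof -
    have "measure M (sym_diff A C) \<le> measure M (sym_diff A B) + measure M (sym_diff B C)"
      if "finite_measure M" "A \<in> sets M" "B \<in> sets M" "C \<in> sets M" for M
    proof -
      interpret M: finite_measure M by fact
      have "measure M (sym_diff A C) \<le> measure M (sym_diff A B \<union> sym_diff B C)"
        using that by (intro M.finite_measure_mono) auto
      also have "\<dots> \<le> measure M (sym_diff A B) + measure M (sym_diff B C)"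
        using that by (intro measure_Un_le) auto
      finally show ?thesis .
    qed
    from this[OF P] this[OF Q] that PQ show ?thesis by (force simp: d_def)
  qed
  have un: "d (A \<union> A') (B \<union> B') \<le> d A B + d A' B'"
    if "A \<in> sets P" "B \<in> sets P" "A' \<in> sets P" "B' \<in> sets P" for A B A' B'
  proof -
    have "measure M (sym_diff (A \<union> A') (B \<union> B')) \<le> measure M (sym_diff A B) + measure M (sym_diff A' B')"
      if "finite_measure M" "A \<in> sets M" "B \<in> sets M" "A' \<in> sets M" "B' \<in> sets M" for M
    proof -
      interpret M: finite_measure M by fact
      have "measure M (sym_diff (A \<union> A') (B \<union> B')) \<le> measure M (sym_diff A B \<union> sym_diff A' B')"
        using that by (intro M.finite_measure_mono) auto
      also have "\<dots> \<le> measure M (sym_diff A B) + measure M (sym_diff A' B')"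
        using that by (intro measure_Un_le) auto
      finally show ?thesis .
    qed
    from this[OF P] this[OF Q] that PQ show ?thesis by (force simp: d_def)
  qed
  have empty: "{} \<in> G" using F[of 0] by (auto simp: G_def sigma_algebra_iff algebra_def ring_of_sets_iff)
  have GUn: "B \<union> C \<in> G" if "B \<in> G" "C \<in> G" for B C
  proof -
    from that obtain m l where "B \<in> F m" "C \<in> F l" by (auto simp: G_def)
    then have "B \<in> F (max m l)" "C \<in> F (max m l)"
      using mono by (auto simp: incseq_def le_fun_def) (meson max.cobounded1 max.cobounded2 subsetD)+
    then show ?thesis
      using F[of "max m l"] by (auto simp: G_def sigma_algebra_def algebra_def intro: ring_of_sets.Un)
  qed
  have fin: "\<exists>B\<in>G. d (\<Union>i<N. A i) B < \<epsilon>"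
    if "\<And>i \<epsilon>. \<epsilon> > 0 \<Longrightarrow> \<exists>B\<in>G. d (A i) B < \<epsilon>" "\<And>i. A i \<in> sets P" "\<epsilon> > 0" for A :: "nat \<Rightarrow> 'a set" and N :: nat and \<epsilon>
    using \<open>\<epsilon> > 0\<close>
  proof (induction N arbitrary: \<epsilon>)
    case 0
    then show ?case using empty by (auto intro!: bexI[of _ "{}"] simp: d_def)
  next
    case (Suc N)
    from Suc.IH[of "\<epsilon>/2"] Suc.prems obtain B where B: "B \<in> G" "d (\<Union>i<N. A i) B < \<epsilon>/2" by auto
    from that(1)[of "\<epsilon>/2" N] Suc.prems obtain C where C: "C \<in> G" "d (A N) C < \<epsilon>/2" by auto
    have "d (\<Union>i<Suc N. A i) (C \<union> B) \<le> d (A N) C + d (\<Union>i<N. A i) B"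
      unfolding lessThan_Suc using un[of "A N" C "\<Union>i<N. A i" B] that(2) GP B C by simp
    then show ?case using B C GUn by (intro bexI[of _ "C \<union> B"]) auto
  qed
  have "A \<in> sigma_sets (space P) G" using A gen by (simp add: G_def)
  then have "\<forall>\<epsilon>>0. \<exists>B\<in>G. d A B < \<epsilon>"
  proof (induction rule: sigma_sets.induct)
    case (Basic a)
    then show ?case by (auto intro!: bexI[of _ a] simp: d_def)
  next
    case Empty
    then show ?case using empty by (auto intro!: bexI[of _ "{}"] simp: d_def)
  next
    case (Compl a)
    have a: "a \<subseteq> space P"
      using Compl.hyps gen sets.sets_into_space[of a P] by (simp add: G_def)
    show ?case
    proof safe
      fix \<epsilon> :: real assume "\<epsilon> > 0"
      then obtain B where B: "B \<in> G" "d a B < \<epsilon>" using Compl.IH by auto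
      have "space P - B \<in> G"
        using B F by (auto simp: G_def sigma_algebra_iff2)
      moreover have "B \<subseteq> space P" using GP[OF B(1)] by (rule sets.sets_into_space)
      then have "sym_diff (space P - a) (space P - B) = sym_diff a B" using a by auto
      then have "d (space P - a) (space P - B) = d a B" by (simp add: d_def)
      ultimately show "\<exists>B\<in>G. d (space P - a) B < \<epsilon>"
        using B by (intro bexI[of _ "space P - B"]) auto
    qed
  next
    case (Union a)
    have a: "a i \<in> sets P" for i
      using Union.hyps[of i] gen by (simp add: G_def)
    show ?case
    proof safe
      fix \<epsilon> :: real assume \<epsilon>: "\<epsilon> > 0"
      have lim: "(\<lambda>N. measure M (\<Union>i<N. a i)) \<longlonglongrightarrow> measure M (\<Union>i. a i)"
        if "finite_measure M" "\<And>i. a i \<in> sets M" for M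
      proof -
        interpret M: finite_measure M by fact
        have "(\<lambda>N. measure M (\<Union>i<N. a i)) \<longlonglongrightarrow> measure M (\<Union>N. \<Union>i<N. a i)"
          using that by (intro M.finite_Lim_measure_incseq) (auto simp: incseq_def, meson lessThan_iff less_le_trans)
        also have "(\<Union>N. \<Union>i<N. a i) = (\<Union>i. a i)" by auto
        finally show ?thesis .
      qed
      have sd: "measure M (sym_diff (\<Union>i. a i) (\<Union>i<N. a i)) = measure M (\<Union>i. a i) - measure M (\<Union>i<N. a i)"
        if "finite_measure M" "\<And>i. a i \<in> sets M" for M N
      proof -
        interpret M: finite_measure M by fact
        have "sym_diff (\<Union>i. a i) (\<Union>i<N. a i) = (\<Union>i. a i) - (\<Union>i<N. a i)" by auto
        then show ?thesis using that M.finite_measure_Diff[of "\<Union>i. a i" "\<Union>i<N. a i"] by auto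
      qed
      have "(\<lambda>N. (measure P (\<Union>i. a i) - measure P (\<Union>i<N. a i)) + (measure Q (\<Union>i. a i) - measure Q (\<Union>i<N. a i)))
          \<longlonglongrightarrow> (measure P (\<Union>i. a i) - measure P (\<Union>i. a i)) + (measure Q (\<Union>i. a i) - measure Q (\<Union>i. a i))"
        using a PQ by (intro tendsto_intros lim P Q) auto
      then have "(\<lambda>N. d (\<Union>i. a i) (\<Union>i<N. a i)) \<longlonglongrightarrow> 0"
        using sd[OF P] sd[OF Q] a PQ by (simp add: d_def)
      then have "eventually (\<lambda>N. d (\<Union>i. a i) (\<Union>i<N. a i) < \<epsilon>/2) sequentially"
        using \<epsilon> by (intro order_tendstoD) auto
      then obtain N where N: "d (\<Union>i. a i) (\<Union>i<N. a i) < \<epsilon>/2" by (auto simp: eventually_sequentially)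
      obtain B where B: "B \<in> G" "d (\<Union>i<N. a i) B < \<epsilon>/2"
        using fin[of a "\<epsilon>/2" N] Union.IH a \<epsilon> by auto
      have "d (\<Union>i. a i) B \<le> d (\<Union>i. a i) (\<Union>i<N. a i) + d (\<Union>i<N. a i) B"
        using a GP[OF B(1)] by (intro tri) auto
      then show "\<exists>B\<in>G. d (\<Union>i. a i) B < \<epsilon>" using N B by force
    qed
  qed
  then show ?thesis using \<epsilon> by (auto simp: d_def G_def)
qed

lemma null_sets_of_filtration_bound:
  fixes F :: "nat \<Rightarrow> 'a set set"
  assumes P: "finite_measure P" and Q: "finite_measure Q" and PQ: "sets Q = sets P"
    and F: "\<And>m. sigma_algebra (space P) (F m)" "incseq F"
    and gen: "sets P = sigma_sets (space P) (\<Union>m. F m)"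
    and bound: "\<And>m B t. B \<in> F m \<Longrightarrow> t > 0 \<Longrightarrow> measure P B \<le> t * C + measure Q B / t"
  shows "null_sets Q \<subseteq> null_sets P"
proof
  interpret P: finite_measure P by fact
  interpret Q: finite_measure Q by fact
  fix A assume A: "A \<in> null_sets Q"
  then have AP: "A \<in> sets P" using PQ by auto
  have *: "measure P A \<le> t * C" if t: "t > 0" for t
  proof (rule field_le_epsilon)
    fix e :: real assume e: "e > 0"
    define \<delta> where "\<delta> = e / (1 + 1 / t)"
    have \<delta>: "\<delta> > 0" using e t by (auto simp: \<delta>_def intro!: divide_pos_pos add_pos_pos)
    obtain B m where B: "B \<in> F m" and d: "measure P (sym_diff A B) + measure Q (sym_diff A B) < \<delta>"
      using symdiff_approximation[OF P Q PQ F gen AP \<delta>] by auto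
    have BP: "B \<in> sets P" using B unfolding gen by auto
    have "measure P A \<le> measure P (B \<union> sym_diff A B)"
      using AP BP by (intro P.finite_measure_mono) auto
    also have "\<dots> \<le> measure P B + measure P (sym_diff A B)"
      using AP BP by (intro measure_Un_le) auto
    finally have 1: "measure P A \<le> measure P B + measure P (sym_diff A B)" .
    have "measure Q B \<le> measure Q (A \<union> sym_diff A B)"
      using AP BP PQ by (intro Q.finite_measure_mono) auto
    also have "\<dots> \<le> measure Q A + measure Q (sym_diff A B)"
      using AP BP PQ by (intro measure_Un_le) auto
    also have "measure Q A = 0" using A by (auto simp: measure_def)
    finally have 2: "measure Q B \<le> measure Q (sym_diff A B)" by simp
    have "measure Q B < \<delta>" "measure P (sym_diff A B) < \<delta>"
      using 2 d measure_nonneg[of P "sym_diff A B"] measure_nonneg[of Q "sym_diff A B"] by linarith+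
    moreover from \<open>measure Q B < \<delta>\<close> have "measure Q B / t \<le> \<delta> / t" using t by (simp add: divide_right_mono)
    ultimately have "measure P A \<le> t * C + (\<delta> / t + \<delta>)"
      using bound[OF B t] 1 by linarith
    also have "\<delta> / t + \<delta> = \<delta> * (1 + 1 / t)" by (simp add: algebra_simps)
    also have "\<dots> = e" using t add_pos_pos[of 1 "1 / t"] by (simp add: \<delta>_def)
    finally show "measure P A \<le> t * C + e" .
  qed
  have "((\<lambda>t. t * C) \<longlongrightarrow> 0 * C) (at_right 0)" by (intro tendsto_intros)
  then have "measure P A \<le> 0 * C"
    by (rule tendsto_lowerbound) (auto simp: eventually_at_filter *)
  then have "measure P A = 0" using measure_nonneg[of P A] by simp
  then show "A \<in> null_sets P" using AP by (auto simp: null_sets_def P.emeasure_eq_measure)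
qed

subsection \<open>Kernels and posteriors in dominated models\<close>

lemma measurable_PiM_prob_algebra:
  assumes k: "\<And>i. i \<in> I \<Longrightarrow> k i \<in> M \<rightarrow>\<^sub>M prob_algebra (N i)"
  shows "(\<lambda>x. \<Pi>\<^sub>M i\<in>I. k i x) \<in> M \<rightarrow>\<^sub>M prob_algebra (PiM I N)"
proof (rule measurable_prob_algebra_generated[OF sets_PiM Int_stable_prod_algebra prod_algebra_sets_into_space])
  have k': "prob_space (k i x)" "sets (k i x) = sets (N i)" if "i \<in> I" "x \<in> space M" for i x
    using measurable_space[OF k[OF that(1)] that(2)] by (auto simp: space_prob_algebra)
  fix x assume x: "x \<in> space M"
  show "prob_space (\<Pi>\<^sub>M i\<in>I. k i x)" using k' x by (intro prob_space_PiM) auto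
  show "sets (\<Pi>\<^sub>M i\<in>I. k i x) = sets (PiM I N)" using k' x by (intro sets_PiM_cong) auto
next
  have k': "prob_space (k i x)" "sets (k i x) = sets (N i)" "space (k i x) = space (N i)" if "i \<in> I" "x \<in> space M" for i x
    using measurable_space[OF k[OF that(1)] that(2)] by (auto simp: space_prob_algebra dest: sets_eq_imp_space_eq)
  fix A assume "A \<in> prod_algebra I N"
  then obtain J E where A: "A = prod_emb I N J (Pi\<^sub>E J E)" and J: "finite J" "J \<subseteq> I"
    and E: "\<And>i. i \<in> J \<Longrightarrow> E i \<in> sets (N i)"
    by (rule prod_algebraE) blast
  have "(\<lambda>x. \<Prod>i\<in>J. emeasure (k i x) (E i)) \<in> borel_measurable M"
  proof (intro borel_measurable_prod_ennreal)
    fix i assume "i \<in> J"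
    then show "(\<lambda>x. emeasure (k i x) (E i)) \<in> borel_measurable M"
      using J E measurable_emeasure_kernel[OF measurable_prob_algebraD[OF k]] by blast
  qed
  also have "?this \<longleftrightarrow> (\<lambda>x. emeasure (\<Pi>\<^sub>M i\<in>I. k i x) A) \<in> borel_measurable M"
  proof (intro measurable_cong)
    fix x assume x: "x \<in> space M"
    have "A = prod_emb I (\<lambda>i. k i x) J (Pi\<^sub>E J E)"
      unfolding A using k' x by (auto simp: prod_emb_def PiE_iff)
    then show "(\<Prod>i\<in>J. emeasure (k i x) (E i)) = emeasure (\<Pi>\<^sub>M i\<in>I. k i x) A"
      using k' x J E by (simp add: emeasure_PiM_emb subset_eq)
  qed
  finally show "(\<lambda>x. emeasure (\<Pi>\<^sub>M i\<in>I. k i x) A) \<in> borel_measurable M" .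
qed

lemma measurable_normal_prob_algebra:
  assumes f: "f \<in> borel_measurable M" and s: "s > 0"
  shows "(\<lambda>x. density lborel (normal_density (f x) s)) \<in> M \<rightarrow>\<^sub>M prob_algebra borel"
proof (intro measurable_prob_algebraI measurable_subprob_algebra)
  show "prob_space (density lborel (normal_density (f x) s))" for x
    using s by (rule prob_space_normal_density)
  then show "subprob_space (density lborel (normal_density (f x) s))" for x
    by (rule prob_space_imp_subprob_space)
  show "sets (density lborel (normal_density (f x) s)) = sets borel" for x by simp
  fix A :: "real set" assume A: "A \<in> sets borel"
  note f[measurable] A[measurable]
  have "(\<lambda>x. \<integral>\<^sup>+y. ennreal (normal_density (f x) s y) * indicator A y \<partial>lborel) \<in> borel_measurable M"
    unfolding normal_density_def by measurable
  then show "(\<lambda>x. emeasure (density lborel (normal_density (f x) s)) A) \<in> borel_measurable M"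
    using A by (simp add: emeasure_density)
qed

lemma posterior_eq_likelihood_ratio_AE:
  fixes L :: "'t \<Rightarrow> 'x \<Rightarrow> ennreal"
  assumes post: "is_posterior \<mu> P X K" and \<mu>: "prob_space \<mu>"
    and P: "P \<in> \<mu> \<rightarrow>\<^sub>M prob_algebra X"
    and R: "prob_space R" and RX[measurable_cong]: "sets R = sets X"
    and L[measurable]: "(\<lambda>(\<theta>, x). L \<theta> x) \<in> borel_measurable (\<mu> \<Otimes>\<^sub>M R)"
    and dens: "AE \<theta> in \<mu>. P \<theta> = density R (L \<theta>)"
    and B[measurable]: "B \<in> sets \<mu>"
  shows "AE x in R. emeasure (K x) B * (\<integral>\<^sup>+\<theta>. L \<theta> x \<partial>\<mu>) = (\<integral>\<^sup>+\<theta>\<in>B. L \<theta> x \<partial>\<mu>)"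
proof -
  interpret \<mu>: prob_space \<mu> by fact
  interpret R: prob_space R by fact
  interpret pair_sigma_finite \<mu> R ..
  define Z where "Z x = (\<integral>\<^sup>+\<theta>. L \<theta> x \<partial>\<mu>)" for x
  define W where "W x = (\<integral>\<^sup>+\<theta>\<in>B. L \<theta> x \<partial>\<mu>)" for x
  have Z[measurable]: "Z \<in> borel_measurable R" unfolding Z_def by measurable
  have W[measurable]: "W \<in> borel_measurable R" unfolding W_def by measurable
  have KB[measurable]: "(\<lambda>x. emeasure (K x) B) \<in> borel_measurable R"
  proof -
    have "K \<in> X \<rightarrow>\<^sub>M prob_algebra \<mu>" using post by (simp add: is_posterior_def)
    then have "(\<lambda>x. emeasure (K x) B) \<in> borel_measurable X"
      using B by (intro measurable_emeasure_kernel[OF measurable_prob_algebraD])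
    then show ?thesis by (simp cong: measurable_cong_sets)
  qed
  have joint: "(\<integral>\<^sup>+\<theta>\<in>C. emeasure (P \<theta>) A \<partial>\<mu>) = (\<integral>\<^sup>+x\<in>A. (\<integral>\<^sup>+\<theta>\<in>C. L \<theta> x \<partial>\<mu>) \<partial>R)"
    if A[measurable]: "A \<in> sets X" and C[measurable]: "C \<in> sets \<mu>" for A C
  proof -
    have "(\<integral>\<^sup>+\<theta>\<in>C. emeasure (P \<theta>) A \<partial>\<mu>) = (\<integral>\<^sup>+\<theta>. \<integral>\<^sup>+x. L \<theta> x * indicator A x * indicator C \<theta> \<partial>R \<partial>\<mu>)"
    proof (intro nn_integral_cong_AE)
      show "AE \<theta> in \<mu>. emeasure (P \<theta>) A * indicator C \<theta> =
          (\<integral>\<^sup>+x. L \<theta> x * indicator A x * indicator C \<theta> \<partial>R)"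
        using dens AE_space
      proof eventually_elim
        fix \<theta> assume d: "P \<theta> = density R (L \<theta>)" and [measurable]: "\<theta> \<in> space \<mu>"
        have "L \<theta> \<in> borel_measurable R" by measurable
        then show "emeasure (P \<theta>) A * indicator C \<theta> =
          (\<integral>\<^sup>+x. L \<theta> x * indicator A x * indicator C \<theta> \<partial>R)"
          unfolding d using A by (simp add: emeasure_density nn_integral_multc RX)
      qed
    qed
    also have "\<dots> = (\<integral>\<^sup>+x. \<integral>\<^sup>+\<theta>. L \<theta> x * indicator A x * indicator C \<theta> \<partial>\<mu> \<partial>R)"
      by (rule Fubini'[symmetric]) measurable
    also have "\<dots> = (\<integral>\<^sup>+x\<in>A. (\<integral>\<^sup>+\<theta>\<in>C. L \<theta> x \<partial>\<mu>) \<partial>R)"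
    proof (intro nn_integral_cong)
      fix x assume [measurable]: "x \<in> space R"
      have "(\<integral>\<^sup>+\<theta>. L \<theta> x * indicator A x * indicator C \<theta> \<partial>\<mu>) = (\<integral>\<^sup>+\<theta>. L \<theta> x * indicator C \<theta> * indicator A x \<partial>\<mu>)"
        by (simp add: ac_simps)
      also have "\<dots> = (\<integral>\<^sup>+\<theta>\<in>C. L \<theta> x \<partial>\<mu>) * indicator A x"
        by (rule nn_integral_multc) measurable
      finally show "(\<integral>\<^sup>+\<theta>. L \<theta> x * indicator A x * indicator C \<theta> \<partial>\<mu>) = (\<integral>\<^sup>+\<theta>\<in>C. L \<theta> x \<partial>\<mu>) * indicator A x" .
    qed
    finally show ?thesis .
  qed
  have marg: "\<mu> \<bind> P = density R Z"
  proof (rule measure_eqI)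
    have \<mu>': "\<mu> \<in> space (prob_algebra \<mu>)" using \<mu> by (simp add: space_prob_algebra)
    show s: "sets (\<mu> \<bind> P) = sets (density R Z)"
      using sets_bind'[OF \<mu>' P] RX by simp
    fix A assume "A \<in> sets (\<mu> \<bind> P)"
    then have A: "A \<in> sets X" using s RX by simp
    have "emeasure (\<mu> \<bind> P) A = (\<integral>\<^sup>+\<theta>. emeasure (P \<theta>) A \<partial>\<mu>)"
      by (rule emeasure_bind_prob_algebra[OF \<mu>' P A])
    also have "\<dots> = (\<integral>\<^sup>+\<theta>\<in>space \<mu>. emeasure (P \<theta>) A \<partial>\<mu>)"
      by (intro nn_integral_cong) simp
    also have "\<dots> = (\<integral>\<^sup>+x\<in>A. (\<integral>\<^sup>+\<theta>\<in>space \<mu>. L \<theta> x \<partial>\<mu>) \<partial>R)"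
      by (rule joint[OF A]) simp
    also have "\<dots> = (\<integral>\<^sup>+x\<in>A. Z x \<partial>R)"
      unfolding Z_def by (intro nn_integral_cong arg_cong2[where f="(*)"] refl) simp
    also have "\<dots> = emeasure (density R Z) A"
      using A RX by (simp add: emeasure_density)
    finally show "emeasure (\<mu> \<bind> P) A = emeasure (density R Z) A" .
  qed
  have "density R (\<lambda>x. emeasure (K x) B * Z x) = density R W"
  proof (rule measure_eqI)
    fix A assume "A \<in> sets (density R (\<lambda>x. emeasure (K x) B * Z x))"
    then have A[measurable]: "A \<in> sets X" using RX by simp
    have "emeasure (density R (\<lambda>x. emeasure (K x) B * Z x)) A = (\<integral>\<^sup>+x. Z x * (emeasure (K x) B * indicator A x) \<partial>R)"
      using A RX by (simp add: emeasure_density ac_simps)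
    also have "\<dots> = (\<integral>\<^sup>+x\<in>A. emeasure (K x) B \<partial>(\<mu> \<bind> P))"
      unfolding marg by (subst nn_integral_density) simp_all
    also have "\<dots> = (\<integral>\<^sup>+\<theta>\<in>B. emeasure (P \<theta>) A \<partial>\<mu>)"
      using post A B by (simp add: is_posterior_def)
    also have "\<dots> = (\<integral>\<^sup>+x\<in>A. W x \<partial>R)"
      unfolding W_def by (rule joint[OF A B])
    also have "\<dots> = emeasure (density R W) A"
      using A RX by (simp add: emeasure_density)
    finally show "emeasure (density R (\<lambda>x. emeasure (K x) B * Z x)) A = emeasure (density R W) A" .
  qed simp
  then show ?thesis
    unfolding Z_def[symmetric] W_def[symmetric] by (intro R.density_unique) simp_all
qed

subsection \<open>The white noise model\<close>

definition likelihood_ratio :: "nat \<Rightarrow> real \<Rightarrow> real \<Rightarrow> real" where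
  "likelihood_ratio n \<theta> x = exp (real n * \<theta> * x - real n * \<theta>\<^sup>2 / 2)"

lemma likelihood_ratio_pos: "likelihood_ratio n \<theta> x > 0"
  by (simp add: likelihood_ratio_def)

lemma likelihood_ratio_power2:
  "(likelihood_ratio n \<theta> x)\<^sup>2 = exp (real n * \<theta>\<^sup>2) * likelihood_ratio n (2 * \<theta>) x"
  unfolding likelihood_ratio_def power2_eq_square exp_add[symmetric]
  by (simp add: algebra_simps)

lemma borel_measurable_likelihood_ratio[measurable]:
  assumes [measurable]: "f \<in> borel_measurable M" "g \<in> borel_measurable M"
  shows "(\<lambda>x. likelihood_ratio n (f x) (g x)) \<in> borel_measurable M"
  unfolding likelihood_ratio_def by measurable

lemma normal_density_eq_likelihood_ratio:
  assumes "n \<ge> 1"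
  shows "normal_density \<theta> (1 / sqrt (real n)) x =
    normal_density 0 (1 / sqrt (real n)) x * likelihood_ratio n \<theta> x"
proof -
  have "- (x - \<theta>)\<^sup>2 / (2 * (1 / sqrt (real n))\<^sup>2) =
      - (x - 0)\<^sup>2 / (2 * (1 / sqrt (real n))\<^sup>2) + (real n * \<theta> * x - real n * \<theta>\<^sup>2 / 2)"
    using assms by (simp add: power_divide power2_diff field_simps)
  then show ?thesis
    unfolding normal_density_def likelihood_ratio_def mult.assoc exp_add[symmetric] by simp
qed

lemma prob_space_normal_noise:
  "n \<ge> 1 \<Longrightarrow> prob_space (density lborel (normal_density \<theta> (1 / sqrt (real n))))"
  by (intro prob_space_normal_density) simp

lemma sets_white_noise[simp, measurable_cong]: "sets (white_noise n \<theta>) = sets seq_space"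
  unfolding white_noise_def seq_space_def by (intro sets_PiM_cong) simp_all

lemma space_white_noise[simp]: "space (white_noise n \<theta>) = space seq_space"
  by (rule sets_eq_imp_space_eq) simp

lemma prob_space_white_noise: "n \<ge> 1 \<Longrightarrow> prob_space (white_noise n \<theta>)"
  unfolding white_noise_def by (intro prob_space_PiM prob_space_normal_noise)

lemma measurable_component_seq_space[measurable]:
  "i \<ge> 1 \<Longrightarrow> (\<lambda>x. x i) \<in> borel_measurable seq_space"
  unfolding seq_space_def by measurable

lemma white_noise_eq_density:
  assumes n: "n \<ge> 1" and J: "finite J" "J \<subseteq> {1..}" and \<theta>: "\<And>i. i \<in> {1..} - J \<Longrightarrow> \<theta> i = 0"
  shows "white_noise n \<theta> = density (white_noise n (\<lambda>_. 0))
    (\<lambda>x. \<Prod>i\<in>J. ennreal (likelihood_ratio n (\<theta> i) (x i)))"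
  unfolding white_noise_def
proof (rule PiM_density_finite[OF prob_space_normal_noise[OF n] prob_space_normal_noise[OF n] J])
  fix i assume "i \<in> J"
  show "density lborel (normal_density (\<theta> i) (1 / sqrt (real n))) =
    density (density lborel (normal_density 0 (1 / sqrt (real n)))) (\<lambda>x. ennreal (likelihood_ratio n (\<theta> i) x))"
    by (subst density_density_eq)
       (auto simp: normal_density_eq_likelihood_ratio[OF n, of "\<theta> i"] ennreal_mult likelihood_ratio_pos less_imp_le
         intro!: density_cong)
qed (use \<theta> in auto)

lemma measurable_white_noise:
  assumes n: "n \<ge> 1" and f: "\<And>i. i \<ge> 1 \<Longrightarrow> (\<lambda>\<theta>. \<theta> i) \<in> borel_measurable M"
  shows "white_noise n \<in> M \<rightarrow>\<^sub>M prob_algebra seq_space"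
  unfolding white_noise_def[abs_def] seq_space_def
  using n by (intro measurable_PiM_prob_algebra measurable_normal_prob_algebra f) auto

definition seq_filtration :: "nat \<Rightarrow> (nat \<Rightarrow> real) set set" where
  "seq_filtration m = sets (vimage_algebra (space seq_space) (\<lambda>x. restrict x {1..m}) (\<Pi>\<^sub>M i\<in>{1..m}. borel))"

lemma measurable_restrict_seq_space:
  "(\<lambda>x. restrict x {1..m}) \<in> seq_space \<rightarrow>\<^sub>M (\<Pi>\<^sub>M i\<in>{1..m}. borel :: real measure)"
  unfolding seq_space_def by (intro measurable_restrict_subset) auto

lemma mem_seq_filtration_iff:
  "B \<in> seq_filtration m \<longleftrightarrow>
    (\<exists>X\<in>sets (\<Pi>\<^sub>M i\<in>{1..m}. borel). B = (\<lambda>x. restrict x {1..m}) -` X \<inter> space seq_space)"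
  unfolding seq_filtration_def
  by (subst sets_vimage_algebra2) (use measurable_space[OF measurable_restrict_seq_space] in auto)

lemma sigma_algebra_seq_filtration: "sigma_algebra (space seq_space) (seq_filtration m)"
  unfolding seq_filtration_def
  using sets.sigma_algebra_axioms[of "vimage_algebra (space seq_space) (\<lambda>x. restrict x {1..m}) (\<Pi>\<^sub>M i\<in>{1..m}. borel)"]
  by simp

lemma incseq_seq_filtration: "incseq seq_filtration"
proof (rule incseq_SucI, rule subsetI)
  fix m B assume "B \<in> seq_filtration m"
  then obtain X where X: "X \<in> sets (\<Pi>\<^sub>M i\<in>{1..m}. borel)"
    and B: "B = (\<lambda>x. restrict x {1..m}) -` X \<inter> space seq_space"
    by (auto simp: mem_seq_filtration_iff)
  define Y where "Y = (\<lambda>x. restrict x {1..m}) -` X \<inter> space (\<Pi>\<^sub>M i\<in>{1..Suc m}. borel :: real measure)"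
  have "Y \<in> sets (\<Pi>\<^sub>M i\<in>{1..Suc m}. borel)"
    unfolding Y_def by (rule measurable_sets[OF measurable_restrict_subset X]) auto
  moreover have "B = (\<lambda>x. restrict x {1..Suc m}) -` Y \<inter> space seq_space"
    unfolding B Y_def by (auto simp: space_PiM restrict_restrict Int_absorb1)
  ultimately show "B \<in> seq_filtration (Suc m)" by (auto simp: mem_seq_filtration_iff)
qed

lemma sets_seq_space_eq: "sets seq_space = sigma_sets (space seq_space) (\<Union>m. seq_filtration m)"
proof
  have "{f \<in> \<Pi>\<^sub>E i\<in>{1..}. space borel. f i \<in> A} \<in> seq_filtration i"
    if "i \<ge> 1" "A \<in> sets borel" for i and A :: "real set"
    unfolding mem_seq_filtration_iff
  proof (rule bexI)
    have "(\<lambda>x. x i) -` A \<inter> space (\<Pi>\<^sub>M i\<in>{1..i}. borel :: real measure) \<in> sets (\<Pi>\<^sub>M i\<in>{1..i}. borel)"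
      using that by (intro measurable_sets[OF measurable_component_singleton]) auto
    then show "{f \<in> space (\<Pi>\<^sub>M i\<in>{1..i}. borel :: real measure). f i \<in> A} \<in> sets (\<Pi>\<^sub>M i\<in>{1..i}. borel)"
      by (simp add: vimage_def Int_def conj_commute)
    show "{f \<in> \<Pi>\<^sub>E i\<in>{1..}. space borel. f i \<in> A} = (\<lambda>x. restrict x {1..i}) -`
        {f \<in> space (\<Pi>\<^sub>M i\<in>{1..i}. borel :: real measure). f i \<in> A} \<inter> space seq_space"
      using that by (auto simp: seq_space_def space_PiM)
  qed
  then show "sets seq_space \<subseteq> sigma_sets (space seq_space) (\<Union>m. seq_filtration m)"
    unfolding seq_space_def sets_PiM_single space_PiM
    by (intro sigma_sets_mono') (auto simp: seq_space_def space_PiM)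
  show "sigma_sets (space seq_space) (\<Union>m. seq_filtration m) \<subseteq> sets seq_space"
    by (intro sets.sigma_sets_subset)
       (auto simp: mem_seq_filtration_iff intro!: measurable_sets[OF measurable_restrict_seq_space])
qed

lemma emeasure_white_noise_cong_filtration:
  assumes n: "n \<ge> 1" and B: "B \<in> seq_filtration m" and eq: "\<And>i. 1 \<le> i \<Longrightarrow> i \<le> m \<Longrightarrow> \<theta> i = \<theta>' i"
  shows "emeasure (white_noise n \<theta>) B = emeasure (white_noise n \<theta>') B"
proof -
  obtain X where X: "X \<in> sets (\<Pi>\<^sub>M i\<in>{1..m}. borel)"
    and BX: "B = (\<lambda>x. restrict x {1..m}) -` X \<inter> space seq_space"
    using B by (auto simp: mem_seq_filtration_iff)
  have *: "emeasure (white_noise n \<theta>) B =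
      emeasure (\<Pi>\<^sub>M i\<in>{1..m}. density lborel (normal_density (\<theta> i) (1 / sqrt (real n)))) X" for \<theta>
  proof -
    let ?N = "\<lambda>i. density lborel (normal_density (\<theta> i) (1 / sqrt (real n)))"
    have s: "sets (\<Pi>\<^sub>M i\<in>{1..m}. ?N i) = sets (\<Pi>\<^sub>M i\<in>{1..m}. borel)"
      by (intro sets_PiM_cong) simp_all
    have "distr (white_noise n \<theta>) (\<Pi>\<^sub>M i\<in>{1..m}. ?N i) (\<lambda>x. restrict x {1..m}) = (\<Pi>\<^sub>M i\<in>{1..m}. ?N i)"
      unfolding white_noise_def
      using distr_PiM_reindex[of "{1..}" ?N "\<lambda>x. x" "{1..m}"] prob_space_normal_noise[OF n]
      by (simp add: restrict_def)
    then have "emeasure (\<Pi>\<^sub>M i\<in>{1..m}. ?N i) X =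
        emeasure (distr (white_noise n \<theta>) (\<Pi>\<^sub>M i\<in>{1..m}. ?N i) (\<lambda>x. restrict x {1..m})) X" by simp
    also have "\<dots> = emeasure (white_noise n \<theta>) B"
      unfolding BX using X s measurable_restrict_seq_space[of m]
      by (subst emeasure_distr) (simp_all cong: measurable_cong_sets)
    finally show ?thesis ..
  qed
  have "(\<Pi>\<^sub>M i\<in>{1..m}. density lborel (normal_density (\<theta> i) (1 / sqrt (real n)))) =
      (\<Pi>\<^sub>M i\<in>{1..m}. density lborel (normal_density (\<theta>' i) (1 / sqrt (real n))))"
    using eq by (intro PiM_cong) auto
  then show ?thesis unfolding * by simp
qed

text \<open>On cylinders the density \<open>L\<close> with respect to the law with parameter \<open>0\<close> satisfies
  \<open>L \<le> t L\<^sup>2 + 1 / t\<close>, and the second moment of \<open>L\<close> is at most \<open>exp (n \<parallel>\<theta>\<parallel>\<^sup>2)\<close>, uniformly in the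
  dimension, since \<open>L\<^sup>2\<close> is a constant times the density for the parameter \<open>2\<theta>\<close>.\<close>

lemma null_sets_white_noise:
  assumes n: "n \<ge> 1" and \<theta>: "\<theta> \<in> ell2"
  shows "null_sets (white_noise n (\<lambda>_. 0)) \<subseteq> null_sets (white_noise n \<theta>)"
proof -
  let ?P0 = "white_noise n (\<lambda>_. 0)"
  define S where "S = (\<Sum>\<^sub>\<infinity>i\<in>{1..}. (\<theta> i)\<^sup>2)"
  have fin: "finite_measure (white_noise n \<theta>)" for \<theta>
    using prob_space_white_noise[OF n, of \<theta>] by (simp add: prob_space_def)
  show ?thesis
  proof (rule null_sets_of_filtration_bound[OF fin fin])
    show "sets ?P0 = sets (white_noise n \<theta>)" by simp
    show "sigma_algebra (space (white_noise n \<theta>)) (seq_filtration m)" for m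
      by (simp add: sigma_algebra_seq_filtration)
    show "incseq seq_filtration" by (rule incseq_seq_filtration)
    show "sets (white_noise n \<theta>) = sigma_sets (space (white_noise n \<theta>)) (\<Union>m. seq_filtration m)"
      using sets_seq_space_eq by simp
    fix m B and t :: real assume B: "B \<in> seq_filtration m" and t: "t > 0"
    have [measurable]: "B \<in> sets seq_space" using B sets_seq_space_eq by auto
    define \<theta>' where "\<theta>' i = (if 1 \<le> i \<and> i \<le> m then \<theta> i else 0)" for i
    define L where "L c x = (\<Prod>i\<in>{1..m}. likelihood_ratio n (c * \<theta>' i) (x i))" for c x
    have L_pos: "L c x > 0" for c x unfolding L_def by (intro prod_pos ballI likelihood_ratio_pos)
    have [measurable]: "L c \<in> borel_measurable seq_space" for c
      unfolding L_def by measurable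
    have dens: "white_noise n (\<lambda>i. c * \<theta>' i) = density ?P0 (\<lambda>x. ennreal (L c x))" for c
      using white_noise_eq_density[OF n, of "{1..m}" "\<lambda>i. c * \<theta>' i"]
      by (auto simp: \<theta>'_def L_def prod_ennreal likelihood_ratio_pos less_imp_le)
    have L2: "(L 1 x)\<^sup>2 = exp (real n * (\<Sum>i\<in>{1..m}. (\<theta>' i)\<^sup>2)) * L 2 x" for x
      by (simp add: L_def prod_power_distrib likelihood_ratio_power2 prod.distrib exp_sum sum_distrib_left)
    have "(\<Sum>i\<in>{1..m}. (\<theta>' i)\<^sup>2) = (\<Sum>i\<in>{1..m}. (\<theta> i)\<^sup>2)"
      by (intro sum.cong) (auto simp: \<theta>'_def)
    also have "\<dots> \<le> S"
      unfolding S_def using \<theta> by (intro finite_sum_le_infsum) (auto simp: ell2_def)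
    finally have S: "(\<Sum>i\<in>{1..m}. (\<theta>' i)\<^sup>2) \<le> S" .
    have le: "L 1 x \<le> t * exp (real n * S) * L 2 x + 1 / t" for x
    proof -
      have "2 * L 1 x \<le> t * (L 1 x)\<^sup>2 + 1 / t"
      proof -
        have "0 \<le> (t * L 1 x - 1)\<^sup>2 / t" using t by simp
        also have "\<dots> = t * (L 1 x)\<^sup>2 + 1 / t - 2 * L 1 x"
          using t by (simp add: power2_diff field_simps power2_eq_square)
        finally show ?thesis by simp
      qed
      also have "t * (L 1 x)\<^sup>2 \<le> t * (exp (real n * S) * L 2 x)"
        unfolding L2 using t S L_pos[of 2 x] by (intro mult_left_mono mult_right_mono) (auto intro: mult_left_mono)
      finally show ?thesis using L_pos[of 1 x] by (simp add: mult.assoc)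
    qed
    have "emeasure (white_noise n \<theta>) B = emeasure (white_noise n (\<lambda>i. 1 * \<theta>' i)) B"
      using B by (intro emeasure_white_noise_cong_filtration[OF n]) (auto simp: \<theta>'_def)
    also have "\<dots> = (\<integral>\<^sup>+x. ennreal (L 1 x) * indicator B x \<partial>?P0)"
      unfolding dens by (subst emeasure_density) simp_all
    also have "\<dots> \<le> (\<integral>\<^sup>+x. ennreal (t * exp (real n * S)) * ennreal (L 2 x) + ennreal (1 / t) * indicator B x \<partial>?P0)"
    proof (intro nn_integral_mono)
      fix x
      have "ennreal (L 1 x) \<le> ennreal (t * exp (real n * S) * L 2 x + 1 / t)"
        by (intro ennreal_leI le)
      also have "\<dots> = ennreal (t * exp (real n * S)) * ennreal (L 2 x) + ennreal (1 / t)"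
        using t L_pos[of 2 x] by (simp add: ennreal_mult)
      finally show "ennreal (L 1 x) * indicator B x \<le>
        ennreal (t * exp (real n * S)) * ennreal (L 2 x) + ennreal (1 / t) * indicator B x"
        by (auto simp: indicator_def)
    qed
    also have "\<dots> = ennreal (t * exp (real n * S)) * (\<integral>\<^sup>+x. ennreal (L 2 x) \<partial>?P0) + ennreal (1 / t) * emeasure ?P0 B"
      by (simp add: nn_integral_add nn_integral_cmult)
    also have "(\<integral>\<^sup>+x. ennreal (L 2 x) \<partial>?P0) = emeasure (white_noise n (\<lambda>i. 2 * \<theta>' i)) (space seq_space)"
      unfolding dens by (subst emeasure_density) (auto intro!: nn_integral_cong)
    also have "\<dots> = 1"
      using prob_space.emeasure_space_1[OF prob_space_white_noise[OF n]] by simp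
    finally have "ennreal (measure (white_noise n \<theta>) B) \<le> ennreal (t * exp (real n * S) + measure ?P0 B / t)"
      using t by (simp add: finite_measure.emeasure_eq_measure[OF fin] ennreal_mult[symmetric] ennreal_plus[symmetric] del: ennreal_plus)
    then show "measure (white_noise n \<theta>) B \<le> t * exp (real n * S) + measure ?P0 B / t"
      using t by (subst (asm) ennreal_le_iff) (auto intro!: add_nonneg_nonneg)
  qed
qed

subsection \<open>The conjugate posterior\<close>

lemma nn_integral_normal_square:
  assumes s: "s > 0"
  shows "(\<integral>\<^sup>+y. ennreal ((y - a)\<^sup>2) \<partial>density lborel (normal_density m s)) = ennreal (s\<^sup>2 + (m - a)\<^sup>2)"
proof -
  have 0: "has_bochner_integral lborel (normal_density m s) 1"
    using s by (simp add: has_bochner_integral_iff)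
  have 1: "has_bochner_integral lborel (\<lambda>y. normal_density m s y * (y - m)) 0"
    using normal_moment_odd[OF s, of m 0] by simp
  have 2: "has_bochner_integral lborel (\<lambda>y. normal_density m s y * (y - m)\<^sup>2) (s\<^sup>2)"
  proof -
    have "fact (2 * 1) / ((2 / s\<^sup>2) ^ 1 * fact 1) = s\<^sup>2"
      using s by (simp add: field_simps)
    from normal_moment_even[OF s, of m 1, unfolded this] show ?thesis
      by (simp only: mult_1_right)
  qed
  have "has_bochner_integral lborel (\<lambda>y. normal_density m s y * (y - m)\<^sup>2 +
      (2 * (m - a)) * (normal_density m s y * (y - m)) + (m - a)\<^sup>2 * normal_density m s y)
      (s\<^sup>2 + (2 * (m - a)) * 0 + (m - a)\<^sup>2 * 1)"
    by (intro has_bochner_integral_add has_bochner_integral_mult_right 0 1 2)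
  also have "(\<lambda>y. normal_density m s y * (y - m)\<^sup>2 +
      (2 * (m - a)) * (normal_density m s y * (y - m)) + (m - a)\<^sup>2 * normal_density m s y) =
      (\<lambda>y. normal_density m s y * (y - a)\<^sup>2)"
    by (intro ext) (simp add: power2_eq_square algebra_simps)
  finally have "has_bochner_integral lborel (\<lambda>y. normal_density m s y * (y - a)\<^sup>2) (s\<^sup>2 + (m - a)\<^sup>2)"
    by simp
  then have "(\<integral>\<^sup>+y. ennreal (normal_density m s y * (y - a)\<^sup>2) \<partial>lborel) = ennreal (s\<^sup>2 + (m - a)\<^sup>2)"
    by (subst nn_integral_eq_integral) (auto simp: has_bochner_integral_iff)
  then show ?thesis
    by (subst nn_integral_density) (simp_all add: ennreal_mult)
qed

lemma nonneg_summable_on_atLeast1_iff: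
  fixes f :: "nat \<Rightarrow> real"
  assumes "\<And>i. f i \<ge> 0"
  shows "f summable_on {1..} \<longleftrightarrow> (\<Sum>i. ennreal (f (Suc i))) \<noteq> \<infinity>"
proof -
  have "f summable_on {1..} \<longleftrightarrow> f summable_on (range Suc)"
    by (simp add: atLeast_Suc_greaterThan greaterThan_0)
  also have "\<dots> \<longleftrightarrow> (f \<circ> Suc) summable_on UNIV"
    by (rule summable_on_reindex) simp
  also have "\<dots> \<longleftrightarrow> summable (f \<circ> Suc)"
    using assms by (subst summable_on_UNIV_nonneg_real_iff) simp_all
  also have "\<dots> \<longleftrightarrow> (\<Sum>i. ennreal (f (Suc i))) \<noteq> \<infinity>"
    using assms by (auto simp: o_def suminf_ennreal_eq[OF _ summable_sums] intro: summable_suminf_not_top)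
  finally show ?thesis .
qed

lemma ennreal_infsum_atLeast1:
  fixes f :: "nat \<Rightarrow> real"
  assumes nn: "\<And>i. f i \<ge> 0" and f: "f summable_on {1..}"
  shows "ennreal (\<Sum>\<^sub>\<infinity>i\<in>{1..}. f i) = (\<Sum>i. ennreal (f (Suc i)))"
proof -
  have eq: "{1..} = range Suc" by (simp add: atLeast_Suc_greaterThan greaterThan_0)
  have "(f \<circ> Suc) summable_on UNIV"
    using f unfolding eq by (subst (asm) summable_on_reindex) simp_all
  then have "(f \<circ> Suc) sums infsum (f \<circ> Suc) UNIV"
    by (intro has_sum_imp_sums has_sum_infsum)
  then have "(\<lambda>i. f (Suc i)) sums infsum f {1..}"
    unfolding eq by (subst infsum_reindex) (simp_all add: o_def)
  then show ?thesis using nn by (intro suminf_ennreal_eq[symmetric]) auto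
qed

lemma mem_ell2_iff: "\<theta> \<in> ell2 \<longleftrightarrow> (\<Sum>i. ennreal ((\<theta> (Suc i))\<^sup>2)) \<noteq> \<infinity>"
  unfolding ell2_def mem_Collect_eq by (rule nonneg_summable_on_atLeast1_iff) simp

lemma ell2_diff:
  assumes "\<theta> \<in> ell2" "\<theta>' \<in> ell2"
  shows "(\<lambda>i. \<theta> i - \<theta>' i) \<in> ell2"
proof -
  have "(\<lambda>i. 2 * (\<theta> i)\<^sup>2 + 2 * (\<theta>' i)\<^sup>2) summable_on {1..}"
    using assms by (intro summable_on_add summable_on_cmult_right) (auto simp: ell2_def)
  moreover have "(\<theta> i - \<theta>' i)\<^sup>2 \<le> 2 * (\<theta> i)\<^sup>2 + 2 * (\<theta>' i)\<^sup>2" for i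
    using zero_le_power2[of "\<theta> i + \<theta>' i"] by (simp add: power2_eq_square algebra_simps)
  ultimately show ?thesis
    unfolding ell2_def by (auto intro: summable_on_comparison_test)
qed

lemma ell2_norm_nonneg: "ell2_norm \<theta> \<ge> 0"
  by (simp add: ell2_norm_def infsum_nonneg)

lemma ennreal_ell2_norm_square:
  assumes "\<theta> \<in> ell2"
  shows "ennreal ((ell2_norm \<theta>)\<^sup>2) = (\<Sum>i. ennreal ((\<theta> (Suc i))\<^sup>2))"
proof -
  have "(ell2_norm \<theta>)\<^sup>2 = (\<Sum>\<^sub>\<infinity>i\<in>{1..}. (\<theta> i)\<^sup>2)"
    unfolding ell2_norm_def by (intro real_sqrt_pow2 infsum_nonneg) simp
  then show ?thesis
    using assms by (simp only: ell2_def mem_Collect_eq ennreal_infsum_atLeast1 zero_le_power2)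
qed

lemma ell2_norm_eq_suminf:
  assumes "\<theta> \<in> ell2"
  shows "ell2_norm \<theta> = sqrt (enn2real (\<Sum>i. ennreal ((\<theta> (Suc i))\<^sup>2)))"
  using ennreal_ell2_norm_square[OF assms, symmetric] ell2_norm_nonneg[of \<theta>] by simp

locale truncated_gaussian =
  fixes k n :: nat and s :: "nat \<Rightarrow> real"
  assumes s_pos: "\<And>i. 1 \<le> i \<Longrightarrow> i \<le> k \<Longrightarrow> s i > 0" and n_pos: "n \<ge> 1"
begin

definition product_prior :: "(nat \<Rightarrow> real) measure" where
  "product_prior = (\<Pi>\<^sub>M i\<in>{1..}. if i \<le> k then density lborel (normal_density 0 (s i)) else return borel 0)"

abbreviation prior :: "(nat \<Rightarrow> real) measure" where
  "prior \<equiv> truncated_gaussian_prior k s"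

lemma prior_eq: "prior = restrict_space product_prior ell2"
  by (simp add: truncated_gaussian_prior_def product_prior_def)

lemma sets_product_prior[simp, measurable_cong]: "sets product_prior = sets seq_space"
  unfolding product_prior_def seq_space_def by (intro sets_PiM_cong) simp_all

lemma space_product_prior[simp]: "space product_prior = space seq_space"
  by (rule sets_eq_imp_space_eq) simp

lemma prob_space_prior_component:
  "i \<in> {1..} \<Longrightarrow> prob_space (if i \<le> k then density lborel (normal_density 0 (s i)) else return borel 0)"
  using s_pos[of i] by (auto intro!: prob_space_normal_density prob_space_return)

lemma prob_space_product_prior: "prob_space product_prior"
  unfolding product_prior_def by (intro prob_space_PiM prob_space_prior_component)

lemma AE_product_prior_zero: "AE \<theta> in product_prior. \<forall>i>k. \<theta> i = 0"
proof -
  have "AE \<theta> in product_prior. \<theta> i = 0" if "i > k" for i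
    unfolding product_prior_def
    using that by (intro AE_PiM_component[OF prob_space_prior_component]) (auto simp: AE_return)
  then show ?thesis by (subst AE_all_countable) auto
qed

lemma finitely_supported_ell2:
  assumes "\<And>i. i > k \<Longrightarrow> \<theta> i = 0"
  shows "\<theta> \<in> ell2"
proof -
  have "(\<lambda>i. (\<theta> i)\<^sup>2) summable_on {1..k}" by simp
  also have "?this \<longleftrightarrow> (\<lambda>i. (\<theta> i)\<^sup>2) summable_on {1..}"
    using assms by (intro summable_on_cong_neutral) auto
  finally show ?thesis by (simp add: ell2_def)
qed

lemma AE_product_prior_ell2: "AE \<theta> in product_prior. \<theta> \<in> ell2"
  using AE_product_prior_zero by eventually_elim (auto intro: finitely_supported_ell2)

lemma sets_ell2: "ell2 \<inter> space seq_space \<in> sets seq_space"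
proof -
  have "{\<theta>\<in>space seq_space. (\<Sum>i. ennreal ((\<theta> (Suc i))\<^sup>2)) \<noteq> \<infinity>} \<in> sets seq_space"
    by measurable
  also have "{\<theta>\<in>space seq_space. (\<Sum>i. ennreal ((\<theta> (Suc i))\<^sup>2)) \<noteq> \<infinity>} = ell2 \<inter> space seq_space"
    by (auto simp: mem_ell2_iff)
  finally show ?thesis .
qed

lemma space_prior: "space prior = ell2 \<inter> space seq_space"
  unfolding prior_eq by (simp add: space_restrict_space Int_commute)

lemma sets_prior_iff: "B \<in> sets prior \<longleftrightarrow> B \<in> sets seq_space \<and> B \<subseteq> ell2"
  unfolding prior_eq using sets_ell2 by (subst sets_restrict_space_iff) auto

lemma prob_space_prior: "prob_space prior"
proof (rule prob_spaceI)
  interpret prob_space product_prior by (rule prob_space_product_prior)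
  have "emeasure product_prior (space product_prior \<inter> ell2) = emeasure product_prior (space product_prior)"
    using AE_product_prior_ell2 sets_ell2 by (intro emeasure_eq_AE) (auto simp: Int_commute)
  then show "emeasure prior (space prior) = 1"
    using emeasure_space_1 sets_ell2
    by (simp add: prior_eq space_restrict_space emeasure_restrict_space Int_commute)
qed

lemma measurable_component_prior[measurable]: "i \<ge> 1 \<Longrightarrow> (\<lambda>\<theta>. \<theta> i) \<in> borel_measurable prior"
  unfolding prior_eq by (intro measurable_restrict_space1) simp

lemma nn_integral_prior:
  "f \<in> borel_measurable seq_space \<Longrightarrow> B \<in> sets prior \<Longrightarrow>
    (\<integral>\<^sup>+\<theta>\<in>B. f \<theta> \<partial>prior) = (\<integral>\<^sup>+\<theta>\<in>B. f \<theta> \<partial>product_prior)"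
  unfolding prior_eq using sets_ell2
  by (subst nn_integral_restrict_space)
     (auto simp: sets_prior_iff prior_eq[symmetric] Int_commute intro!: nn_integral_cong split: split_indicator)

text \<open>\<open>shrinkage i * x i\<close> and \<open>post_sd i\<close> are the mean and standard deviation of the posterior of
  coordinate \<open>i\<close>; \<open>evidence i\<close> is the marginal density of \<open>x i\<close> relative to parameter \<open>0\<close>.\<close>

definition shrinkage :: "nat \<Rightarrow> real" where
  "shrinkage i = real n * (s i)\<^sup>2 / (1 + real n * (s i)\<^sup>2)"

definition post_sd :: "nat \<Rightarrow> real" where
  "post_sd i = s i / sqrt (1 + real n * (s i)\<^sup>2)"

definition evidence :: "nat \<Rightarrow> real \<Rightarrow> real" where
  "evidence i x = exp (real n * shrinkage i * x\<^sup>2 / 2) / sqrt (1 + real n * (s i)\<^sup>2)"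

definition gaussian_posterior :: "(nat \<Rightarrow> real) \<Rightarrow> (nat \<Rightarrow> real) measure" where
  "gaussian_posterior x = (\<Pi>\<^sub>M i\<in>{1..}. if i \<le> k
     then density lborel (normal_density (shrinkage i * x i) (post_sd i)) else return borel 0)"

lemma denom_pos: "1 + real n * (s i)\<^sup>2 > 0"
  by (intro add_pos_nonneg) auto

lemma evidence_pos: "evidence i x > 0"
  using denom_pos[of i] by (simp add: evidence_def)

lemma post_sd_pos: "1 \<le> i \<Longrightarrow> i \<le> k \<Longrightarrow> post_sd i > 0"
  using denom_pos[of i] s_pos[of i] by (simp add: post_sd_def)

lemma shrinkage_pos: "1 \<le> i \<Longrightarrow> i \<le> k \<Longrightarrow> shrinkage i > 0"
  using denom_pos[of i] s_pos[of i] n_pos by (simp add: shrinkage_def)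

lemma normal_conjugacy:
  assumes i: "1 \<le> i" "i \<le> k"
  shows "normal_density 0 (s i) \<theta> * likelihood_ratio n \<theta> x =
    evidence i x * normal_density (shrinkage i * x) (post_sd i) \<theta>"
proof -
  define D where "D = 1 + real n * (s i)\<^sup>2"
  have D: "D > 0" "D \<noteq> 0" using denom_pos[of i] by (auto simp: D_def)
  have s: "s i > 0" "s i \<noteq> 0" using s_pos[OF i] by auto
  have sd2: "(post_sd i)\<^sup>2 = (s i)\<^sup>2 / D" using D by (simp add: post_sd_def D_def power_divide)
  have expo: "- (\<theta> - 0)\<^sup>2 / (2 * (s i)\<^sup>2) + (real n * \<theta> * x - real n * \<theta>\<^sup>2 / 2) =
      real n * shrinkage i * x\<^sup>2 / 2 + - (\<theta> - shrinkage i * x)\<^sup>2 / (2 * (post_sd i)\<^sup>2)"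
  proof -
    have sh: "shrinkage i = real n * (s i)\<^sup>2 / D" by (simp add: shrinkage_def D_def)
    have "- (\<theta> - real n * (s i)\<^sup>2 / D * x)\<^sup>2 / (2 * ((s i)\<^sup>2 / D)) =
      - (\<theta>\<^sup>2 * D / (2 * (s i)\<^sup>2)) + real n * \<theta> * x - real n * (real n * (s i)\<^sup>2 / D) * x\<^sup>2 / 2"
      using D s by (simp add: power2_eq_square field_simps)
    moreover have "\<theta>\<^sup>2 * D / (2 * (s i)\<^sup>2) = \<theta>\<^sup>2 / (2 * (s i)\<^sup>2) + real n * \<theta>\<^sup>2 / 2"
      using s by (simp add: D_def field_simps)
    ultimately show ?thesis unfolding sd2 sh by simp
  qed
  have "1 / sqrt (2 * pi * (s i)\<^sup>2) = 1 / sqrt D * (1 / sqrt (2 * pi * (post_sd i)\<^sup>2))"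
    unfolding sd2 using D s by (simp add: real_sqrt_divide real_sqrt_mult)
  then show ?thesis
    unfolding normal_density_def likelihood_ratio_def evidence_def D_def[symmetric]
    using arg_cong[OF expo, of exp] by (simp only: exp_add) (simp add: field_simps)
qed

lemma prob_space_posterior_component:
  "i \<in> {1..} \<Longrightarrow> prob_space (if i \<le> k
     then density lborel (normal_density (shrinkage i * x i) (post_sd i)) else return borel 0)"
  using post_sd_pos[of i] by (auto intro!: prob_space_normal_density prob_space_return)

lemma gaussian_posterior_eq_density:
  "gaussian_posterior x = density product_prior
     (\<lambda>\<theta>. \<Prod>i\<in>{1..k}. ennreal (likelihood_ratio n (\<theta> i) (x i) / evidence i (x i)))"
  unfolding gaussian_posterior_def product_prior_def
proof (rule PiM_density_finite[OF prob_space_prior_component prob_space_posterior_component])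
  fix i assume i: "i \<in> {1..k}"
  have eq: "normal_density (shrinkage i * x i) (post_sd i) \<theta> =
      normal_density 0 (s i) \<theta> * (likelihood_ratio n \<theta> (x i) / evidence i (x i))" for \<theta>
    using normal_conjugacy[of i \<theta> "x i"] i evidence_pos[of i "x i"] by (simp add: field_simps)
  have "ennreal (normal_density (shrinkage i * x i) (post_sd i) \<theta>) =
      ennreal (normal_density 0 (s i) \<theta>) * ennreal (likelihood_ratio n \<theta> (x i) / evidence i (x i))" for \<theta>
    unfolding eq using likelihood_ratio_pos evidence_pos
    by (intro ennreal_mult) (auto intro!: divide_nonneg_nonneg less_imp_le)
  then have "density lborel (normal_density (shrinkage i * x i) (post_sd i)) =
    density (density lborel (normal_density 0 (s i))) (\<lambda>\<theta>. ennreal (likelihood_ratio n \<theta> (x i) / evidence i (x i)))"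
    by (subst density_density_eq) auto
  then show "(if i \<le> k then density lborel (normal_density (shrinkage i * x i) (post_sd i)) else return borel 0) =
    density (if i \<le> k then density lborel (normal_density 0 (s i)) else return borel 0)
      (\<lambda>\<theta>. ennreal (likelihood_ratio n \<theta> (x i) / evidence i (x i)))"
    using i by simp
qed auto

lemma nn_integral_likelihood:
  assumes B: "B \<in> sets prior"
  shows "(\<integral>\<^sup>+\<theta>\<in>B. (\<Prod>i\<in>{1..k}. ennreal (likelihood_ratio n (\<theta> i) (x i))) \<partial>prior) =
    ennreal (\<Prod>i\<in>{1..k}. evidence i (x i)) * emeasure (gaussian_posterior x) B"
proof -
  have [measurable]: "B \<in> sets seq_space" using B by (simp add: sets_prior_iff)
  have [measurable]: "(\<lambda>\<theta>. \<Prod>i\<in>{1..k}. ennreal (likelihood_ratio n (\<theta> i) (x i) / evidence i (x i))) \<in> borel_measurable seq_space"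
    by (intro borel_measurable_prod_ennreal measurable_compose[OF _ measurable_ennreal] borel_measurable_divide
        borel_measurable_likelihood_ratio borel_measurable_const measurable_component_seq_space) auto
  have "(\<Prod>i\<in>{1..k}. ennreal (likelihood_ratio n (\<theta> i) (x i))) =
    ennreal (\<Prod>i\<in>{1..k}. evidence i (x i)) *
      (\<Prod>i\<in>{1..k}. ennreal (likelihood_ratio n (\<theta> i) (x i) / evidence i (x i)))" for \<theta>
  proof -
    have "ennreal (likelihood_ratio n (\<theta> i) (x i)) =
        ennreal (evidence i (x i)) * ennreal (likelihood_ratio n (\<theta> i) (x i) / evidence i (x i))" for i
      using evidence_pos[of i "x i"] likelihood_ratio_pos[of n "\<theta> i" "x i"]
      by (simp add: ennreal_mult[symmetric])
    then show ?thesis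
      using evidence_pos by (simp add: prod.distrib prod_ennreal less_imp_le)
  qed
  then have "(\<integral>\<^sup>+\<theta>\<in>B. (\<Prod>i\<in>{1..k}. ennreal (likelihood_ratio n (\<theta> i) (x i))) \<partial>product_prior) =
    (\<integral>\<^sup>+\<theta>. ennreal (\<Prod>i\<in>{1..k}. evidence i (x i)) *
      ((\<Prod>i\<in>{1..k}. ennreal (likelihood_ratio n (\<theta> i) (x i) / evidence i (x i))) * indicator B \<theta>) \<partial>product_prior)"
    by (simp add: mult.assoc)
  also have "\<dots> = ennreal (\<Prod>i\<in>{1..k}. evidence i (x i)) * emeasure (gaussian_posterior x) B"
    unfolding gaussian_posterior_eq_density
    by (subst nn_integral_cmult) (simp_all add: emeasure_density)
  finally show ?thesis using B by (subst nn_integral_prior) simp_all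
qed

lemma emeasure_gaussian_posterior_space: "emeasure (gaussian_posterior x) (space prior) = 1"
proof -
  interpret Q: prob_space "gaussian_posterior x"
    unfolding gaussian_posterior_def by (intro prob_space_PiM prob_space_posterior_component)
  have "AE \<theta> in gaussian_posterior x. \<theta> \<in> ell2"
    unfolding gaussian_posterior_eq_density
    using AE_product_prior_ell2 by (subst AE_density) auto
  moreover have sp: "space (gaussian_posterior x) = space seq_space"
    unfolding gaussian_posterior_eq_density by simp
  ultimately have "emeasure (gaussian_posterior x) (ell2 \<inter> space seq_space) = emeasure (gaussian_posterior x) (space (gaussian_posterior x))"
    using sets_ell2 by (intro emeasure_eq_AE) (auto simp: gaussian_posterior_eq_density)
  then show ?thesis by (simp add: space_prior Q.emeasure_space_1)
qed

lemma AE_posterior_eq_gaussian: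
  assumes post: "is_posterior prior (white_noise n) seq_space K"
    and \<theta>\<^sub>0: "\<theta>\<^sub>0 \<in> ell2" and B: "B \<in> sets prior"
  shows "AE x in white_noise n \<theta>\<^sub>0. emeasure (K x) B = emeasure (gaussian_posterior x) B"
proof -
  let ?P0 = "white_noise n (\<lambda>_. 0)"
  let ?L = "\<lambda>\<theta> x. \<Prod>i\<in>{1..k}. ennreal (likelihood_ratio n (\<theta> i) (x i))"
  have "AE x in ?P0. emeasure (K x) B * (\<integral>\<^sup>+\<theta>. ?L \<theta> x \<partial>prior) = (\<integral>\<^sup>+\<theta>\<in>B. ?L \<theta> x \<partial>prior)"
  proof (rule posterior_eq_likelihood_ratio_AE[OF post prob_space_prior _ prob_space_white_noise[OF n_pos] _ _ _ B])
    show "white_noise n \<in> prior \<rightarrow>\<^sub>M prob_algebra seq_space"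
      by (intro measurable_white_noise n_pos measurable_component_prior)
    show "(\<lambda>(\<theta>, x). ?L \<theta> x) \<in> borel_measurable (prior \<Otimes>\<^sub>M ?P0)"
      unfolding case_prod_beta
      by (intro borel_measurable_prod_ennreal measurable_compose[OF _ measurable_ennreal] borel_measurable_likelihood_ratio
          measurable_compose[OF measurable_fst] measurable_compose[OF measurable_snd] measurable_component_prior)
         (auto cong: measurable_cong_sets)
    have "AE \<theta> in product_prior. white_noise n \<theta> = density ?P0 (?L \<theta>)"
      using AE_product_prior_zero
      by eventually_elim (rule white_noise_eq_density[OF n_pos], auto)
    then show "AE \<theta> in prior. white_noise n \<theta> = density ?P0 (?L \<theta>)"
      unfolding prior_eq using sets_ell2 by (subst AE_restrict_space_iff) (auto simp: Int_commute)
  qed simp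
  then have "AE x in ?P0. emeasure (K x) B = emeasure (gaussian_posterior x) B"
  proof eventually_elim
    fix x
    let ?E = "ennreal (\<Prod>i\<in>{1..k}. evidence i (x i))"
    assume eq: "emeasure (K x) B * (\<integral>\<^sup>+\<theta>. ?L \<theta> x \<partial>prior) = (\<integral>\<^sup>+\<theta>\<in>B. ?L \<theta> x \<partial>prior)"
    have "(\<integral>\<^sup>+\<theta>. ?L \<theta> x \<partial>prior) = (\<integral>\<^sup>+\<theta>\<in>space prior. ?L \<theta> x \<partial>prior)"
      by (intro nn_integral_cong) simp
    also have "\<dots> = ?E"
      by (subst nn_integral_likelihood) (simp_all add: emeasure_gaussian_posterior_space)
    finally have "?E * emeasure (K x) B = ?E * emeasure (gaussian_posterior x) B"
      using eq nn_integral_likelihood[OF B, of x] by (simp add: mult.commute)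
    moreover have "?E \<noteq> 0" "?E \<noteq> \<top>"
      using evidence_pos by (auto simp: ennreal_eq_0_iff not_le intro!: prod_pos)
    ultimately show "emeasure (K x) B = emeasure (gaussian_posterior x) B"
      by (simp add: ennreal_mult_cancel_left)
  qed
  then show ?thesis
    using null_sets_white_noise[OF n_pos \<theta>\<^sub>0] by (auto simp: eventually_ae_filter)
qed

subsection \<open>Contraction\<close>

lemma sets_gaussian_posterior[simp, measurable_cong]: "sets (gaussian_posterior x) = sets seq_space"
  unfolding gaussian_posterior_eq_density by simp

definition coordinate_risk :: "(nat \<Rightarrow> real) \<Rightarrow> nat \<Rightarrow> real \<Rightarrow> real" where
  "coordinate_risk \<theta>\<^sub>0 i y =
     (if i \<le> k then (post_sd i)\<^sup>2 + (shrinkage i * y - \<theta>\<^sub>0 i)\<^sup>2 else (\<theta>\<^sub>0 i)\<^sup>2)"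

lemma borel_measurable_coordinate_risk[measurable]: "coordinate_risk \<theta>\<^sub>0 i \<in> borel_measurable borel"
  unfolding coordinate_risk_def by measurable

lemma nn_integral_gaussian_posterior_square:
  assumes i: "i \<ge> 1"
  shows "(\<integral>\<^sup>+\<theta>. ennreal ((\<theta> i - \<theta>\<^sub>0 i)\<^sup>2) \<partial>gaussian_posterior x) = ennreal (coordinate_risk \<theta>\<^sub>0 i (x i))"
proof -
  let ?N = "\<lambda>i. if i \<le> k then density lborel (normal_density (shrinkage i * x i) (post_sd i)) else return borel 0"
  have "(\<integral>\<^sup>+\<theta>. ennreal ((\<theta> i - \<theta>\<^sub>0 i)\<^sup>2) \<partial>gaussian_posterior x) = (\<integral>\<^sup>+y. ennreal ((y - \<theta>\<^sub>0 i)\<^sup>2) \<partial>?N i)"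
    unfolding gaussian_posterior_def
    using i by (intro nn_integral_PiM_component[OF prob_space_posterior_component]) auto
  also have "\<dots> = ennreal (coordinate_risk \<theta>\<^sub>0 i (x i))"
    using i post_sd_pos[of i]
    by (auto simp: nn_integral_normal_square coordinate_risk_def nn_integral_return)
  finally show ?thesis .
qed

lemma sets_posterior_ball_complement:
  assumes \<theta>\<^sub>0: "\<theta>\<^sub>0 \<in> ell2"
  shows "{\<theta> \<in> space prior. ell2_norm (\<lambda>i. \<theta> i - \<theta>\<^sub>0 i) \<ge> r} \<in> sets prior"
proof -
  have "{\<theta> \<in> space prior. sqrt (enn2real (\<Sum>i. ennreal ((\<theta> (Suc i) - \<theta>\<^sub>0 (Suc i))\<^sup>2))) \<ge> r} \<in> sets prior"
    by measurable
  also have "{\<theta> \<in> space prior. sqrt (enn2real (\<Sum>i. ennreal ((\<theta> (Suc i) - \<theta>\<^sub>0 (Suc i))\<^sup>2))) \<ge> r} =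
      {\<theta> \<in> space prior. ell2_norm (\<lambda>i. \<theta> i - \<theta>\<^sub>0 i) \<ge> r}"
    using ell2_norm_eq_suminf[OF ell2_diff[OF _ \<theta>\<^sub>0]] by (auto simp: space_prior)
  finally show ?thesis .
qed

lemma emeasure_gaussian_posterior_le:
  assumes \<theta>\<^sub>0: "\<theta>\<^sub>0 \<in> ell2" and r: "r > 0"
  shows "emeasure (gaussian_posterior x) {\<theta> \<in> space prior. ell2_norm (\<lambda>i. \<theta> i - \<theta>\<^sub>0 i) \<ge> r} \<le>
    ennreal (1 / r\<^sup>2) * (\<Sum>i. ennreal (coordinate_risk \<theta>\<^sub>0 (Suc i) (x (Suc i))))"
proof -
  let ?B = "{\<theta> \<in> space prior. ell2_norm (\<lambda>i. \<theta> i - \<theta>\<^sub>0 i) \<ge> r}"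
  have B: "?B \<in> sets (gaussian_posterior x)"
    using sets_posterior_ball_complement[OF \<theta>\<^sub>0] by (simp add: sets_prior_iff)
  have "emeasure (gaussian_posterior x) ?B = (\<integral>\<^sup>+\<theta>. indicator ?B \<theta> \<partial>gaussian_posterior x)"
    using B by simp
  also have "\<dots> \<le> (\<integral>\<^sup>+\<theta>. ennreal (1 / r\<^sup>2) * (\<Sum>i. ennreal ((\<theta> (Suc i) - \<theta>\<^sub>0 (Suc i))\<^sup>2)) \<partial>gaussian_posterior x)"
  proof (intro nn_integral_mono)
    fix \<theta>
    show "indicator ?B \<theta> \<le> ennreal (1 / r\<^sup>2) * (\<Sum>i. ennreal ((\<theta> (Suc i) - \<theta>\<^sub>0 (Suc i))\<^sup>2))"
    proof (cases "\<theta> \<in> ?B")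
      case True
      then have "r\<^sup>2 \<le> (ell2_norm (\<lambda>i. \<theta> i - \<theta>\<^sub>0 i))\<^sup>2"
        using r by (intro power_mono) auto
      then have "1 \<le> 1 / r\<^sup>2 * (ell2_norm (\<lambda>i. \<theta> i - \<theta>\<^sub>0 i))\<^sup>2"
        using r by (simp add: field_simps)
      then have "1 \<le> ennreal (1 / r\<^sup>2 * (ell2_norm (\<lambda>i. \<theta> i - \<theta>\<^sub>0 i))\<^sup>2)"
        using ennreal_leI[of 1] by simp
      also have "\<dots> = ennreal (1 / r\<^sup>2) * (\<Sum>i. ennreal ((\<theta> (Suc i) - \<theta>\<^sub>0 (Suc i))\<^sup>2))"
      proof -
        have "\<theta> \<in> ell2" using True by (simp add: space_prior)
        from ennreal_ell2_norm_square[OF ell2_diff[OF this \<theta>\<^sub>0]] show ?thesis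
          by (subst ennreal_mult) simp_all
      qed
      finally show ?thesis using True by simp
    qed simp
  qed
  also have "\<dots> = ennreal (1 / r\<^sup>2) * (\<Sum>i. \<integral>\<^sup>+\<theta>. ennreal ((\<theta> (Suc i) - \<theta>\<^sub>0 (Suc i))\<^sup>2) \<partial>gaussian_posterior x)"
    by (subst nn_integral_cmult) (simp_all add: nn_integral_suminf)
  also have "\<dots> = ennreal (1 / r\<^sup>2) * (\<Sum>i. ennreal (coordinate_risk \<theta>\<^sub>0 (Suc i) (x (Suc i))))"
    by (simp add: nn_integral_gaussian_posterior_square)
  finally show ?thesis .
qed

lemma nn_integral_coordinate_risk:
  assumes i: "i \<ge> 1"
  shows "(\<integral>\<^sup>+x. ennreal (coordinate_risk \<theta>\<^sub>0 i (x i)) \<partial>white_noise n \<theta>\<^sub>0) =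
    ennreal (if i \<le> k then (post_sd i)\<^sup>2 + (shrinkage i)\<^sup>2 / real n + (1 - shrinkage i)\<^sup>2 * (\<theta>\<^sub>0 i)\<^sup>2
      else (\<theta>\<^sub>0 i)\<^sup>2)"
proof -
  let ?N = "density lborel (normal_density (\<theta>\<^sub>0 i) (1 / sqrt (real n)))"
  interpret N: prob_space ?N by (rule prob_space_normal_noise[OF n_pos])
  have "(\<integral>\<^sup>+x. ennreal (coordinate_risk \<theta>\<^sub>0 i (x i)) \<partial>white_noise n \<theta>\<^sub>0) = (\<integral>\<^sup>+y. ennreal (coordinate_risk \<theta>\<^sub>0 i y) \<partial>?N)"
    unfolding white_noise_def
    using i by (intro nn_integral_PiM_component[OF prob_space_normal_noise[OF n_pos]]) auto
  also have "\<dots> = ennreal (if i \<le> k then (post_sd i)\<^sup>2 + (shrinkage i)\<^sup>2 / real n + (1 - shrinkage i)\<^sup>2 * (\<theta>\<^sub>0 i)\<^sup>2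
      else (\<theta>\<^sub>0 i)\<^sup>2)"
  proof (cases "i \<le> k")
    case True
    define c where "c = shrinkage i"
    have c: "c > 0" using shrinkage_pos[of i] i True by (simp add: c_def)
    have "(\<integral>\<^sup>+y. ennreal (coordinate_risk \<theta>\<^sub>0 i y) \<partial>?N) =
        (\<integral>\<^sup>+y. ennreal ((post_sd i)\<^sup>2) + ennreal (c\<^sup>2) * ennreal ((y - \<theta>\<^sub>0 i / c)\<^sup>2) \<partial>?N)"
    proof (intro nn_integral_cong)
      fix y
      have "(c * y - \<theta>\<^sub>0 i)\<^sup>2 = c\<^sup>2 * (y - \<theta>\<^sub>0 i / c)\<^sup>2"
        using c by (simp add: power_mult_distrib[symmetric] right_diff_distrib)
      then show "ennreal (coordinate_risk \<theta>\<^sub>0 i y) =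
          ennreal ((post_sd i)\<^sup>2) + ennreal (c\<^sup>2) * ennreal ((y - \<theta>\<^sub>0 i / c)\<^sup>2)"
        using True by (simp add: coordinate_risk_def c_def[symmetric] ennreal_mult)
    qed
    also have "\<dots> = ennreal ((post_sd i)\<^sup>2) + ennreal (c\<^sup>2) * ennreal ((1 / sqrt (real n))\<^sup>2 + (\<theta>\<^sub>0 i - \<theta>\<^sub>0 i / c)\<^sup>2)"
      using n_pos N.emeasure_space_1
      by (simp add: nn_integral_add nn_integral_cmult nn_integral_normal_square)
    also have "\<dots> = ennreal ((post_sd i)\<^sup>2 + c\<^sup>2 * ((1 / sqrt (real n))\<^sup>2 + (\<theta>\<^sub>0 i - \<theta>\<^sub>0 i / c)\<^sup>2))"
      by (simp add: ennreal_mult)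
    also have "c\<^sup>2 * ((1 / sqrt (real n))\<^sup>2 + (\<theta>\<^sub>0 i - \<theta>\<^sub>0 i / c)\<^sup>2) = c\<^sup>2 / real n + (1 - c)\<^sup>2 * (\<theta>\<^sub>0 i)\<^sup>2"
    proof -
      have "c\<^sup>2 * (\<theta>\<^sub>0 i - \<theta>\<^sub>0 i / c)\<^sup>2 = (c * \<theta>\<^sub>0 i - \<theta>\<^sub>0 i)\<^sup>2"
        using c by (simp add: power_mult_distrib[symmetric] right_diff_distrib)
      also have "\<dots> = (1 - c)\<^sup>2 * (\<theta>\<^sub>0 i)\<^sup>2" by (simp add: power2_eq_square algebra_simps)
      finally show ?thesis using n_pos by (simp add: distrib_left power_divide)
    qed
    finally show ?thesis using True by (simp add: c_def add.assoc)
  next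
    case False
    then show ?thesis using N.emeasure_space_1 by (simp add: coordinate_risk_def)
  qed
  finally show ?thesis .
qed

lemma mean_coordinate_risk_le:
  assumes i: "1 \<le> i" "i \<le> k"
  shows "(post_sd i)\<^sup>2 + (shrinkage i)\<^sup>2 / real n + (1 - shrinkage i)\<^sup>2 * t \<le> 2 / real n + \<bar>t\<bar> / (real n * (s i)\<^sup>2)"
proof -
  define D where "D = 1 + real n * (s i)\<^sup>2"
  have s: "s i > 0" using s_pos[OF i] .
  have n: "real n > 0" using n_pos by simp
  have D: "D > 0" "D \<ge> 1" and ns: "real n * (s i)\<^sup>2 > 0" using denom_pos[of i] s n by (auto simp: D_def)
  have "(post_sd i)\<^sup>2 = (s i)\<^sup>2 / D" using D by (simp add: post_sd_def D_def power_divide)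
  also have "\<dots> \<le> 1 / real n" using D n by (simp add: field_simps D_def)
  finally have 1: "(post_sd i)\<^sup>2 \<le> 1 / real n" .
  have sh: "0 \<le> shrinkage i" "shrinkage i \<le> 1"
    using D ns by (auto simp: shrinkage_def D_def[symmetric] field_simps) (auto simp: D_def)
  then have 2: "(shrinkage i)\<^sup>2 / real n \<le> 1 / real n"
    using n by (intro divide_right_mono) (auto simp: power_le_one)
  have "1 - shrinkage i = 1 / D" using D by (simp add: shrinkage_def D_def field_simps)
  moreover have "1 / D * (1 / D) \<le> 1 / D * 1"
    using D by (intro mult_left_mono) simp_all
  ultimately have "(1 - shrinkage i)\<^sup>2 \<le> 1 / D"
    by (simp add: power2_eq_square)
  also have "\<dots> \<le> 1 / (real n * (s i)\<^sup>2)"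
    using ns D by (intro divide_left_mono) (auto simp: D_def)
  finally have "(1 - shrinkage i)\<^sup>2 * \<bar>t\<bar> \<le> 1 / (real n * (s i)\<^sup>2) * \<bar>t\<bar>"
    by (intro mult_right_mono) auto
  moreover have "(1 - shrinkage i)\<^sup>2 * t \<le> (1 - shrinkage i)\<^sup>2 * \<bar>t\<bar>"
    by (intro mult_left_mono) auto
  ultimately show ?thesis using 1 2 by simp
qed

lemma expected_posterior_mass_le:
  assumes post: "is_posterior prior (white_noise n) seq_space K"
    and \<theta>\<^sub>0: "\<theta>\<^sub>0 \<in> ell2" and r: "r > 0"
    and smooth: "(\<lambda>i. (\<theta>\<^sub>0 i)\<^sup>2 * real i powr (2 * \<alpha>)) summable_on {1..}" and \<alpha>: "\<alpha> > 0"
    and k: "k \<ge> 1" and m: "m > 0" "\<And>i. 1 \<le> i \<Longrightarrow> i \<le> k \<Longrightarrow> m \<le> (s i)\<^sup>2 * real i powr (2 * \<alpha>)"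
  shows "(\<integral>x. measure (K x) {\<theta> \<in> space (K x). ell2_norm (\<lambda>i. \<theta> i - \<theta>\<^sub>0 i) \<ge> r} \<partial>white_noise n \<theta>\<^sub>0) \<le>
    (2 * real k / real n + (1 / (real n * m) + real k powr (-2 * \<alpha>)) *
      (\<Sum>\<^sub>\<infinity>i\<in>{1..}. (\<theta>\<^sub>0 i)\<^sup>2 * real i powr (2 * \<alpha>))) / r\<^sup>2" (is "_ \<le> ?bound")
proof -
  let ?P = "white_noise n \<theta>\<^sub>0"
  let ?B = "{\<theta> \<in> space prior. ell2_norm (\<lambda>i. \<theta> i - \<theta>\<^sub>0 i) \<ge> r}"
  let ?w = "\<lambda>i. (\<theta>\<^sub>0 i)\<^sup>2 * real i powr (2 * \<alpha>)"
  define S where "S = (\<Sum>\<^sub>\<infinity>i\<in>{1..}. ?w i)"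
  define C where "C = 1 / (real n * m) + real k powr (-2 * \<alpha>)"
  define b where "b i = (if i \<le> k then 2 / real n else 0) + C * ?w i" for i
  interpret P: prob_space ?P by (rule prob_space_white_noise[OF n_pos])
  have n: "real n > 0" using n_pos by simp
  have K: "K \<in> seq_space \<rightarrow>\<^sub>M prob_algebra prior" using post by (simp add: is_posterior_def)
  have spK: "space (K x) = space prior" "prob_space (K x)" if "x \<in> space seq_space" for x
    using measurable_space[OF K that] by (auto simp: space_prob_algebra dest: sets_eq_imp_space_eq)
  have B: "?B \<in> sets prior" by (rule sets_posterior_ball_complement[OF \<theta>\<^sub>0])
  have Km: "(\<lambda>x. measure (K x) ?B) \<in> borel_measurable seq_space"
    using measurable_compose[OF K measurable_measure_prob_algebra[OF B]] .
  have S: "S \<ge> 0" unfolding S_def by (intro infsum_nonneg) simp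
  have C: "C \<ge> 0" using n m by (simp add: C_def)
  have b: "b i \<ge> 0" for i using C n by (simp add: b_def)
  have summ_b: "b summable_on {1..}" and sum_b: "(\<Sum>\<^sub>\<infinity>i\<in>{1..}. b i) = 2 * real k / real n + C * S"
  proof -
    let ?f = "\<lambda>i. if i \<le> k then 2 / real n else 0"
    have "(?f has_sum (\<Sum>i\<in>{1..k}. ?f i)) {1..k}" by (intro has_sum_finite) simp
    also have "?this \<longleftrightarrow> (?f has_sum (\<Sum>i\<in>{1..k}. ?f i)) {1..}"
      by (intro has_sum_cong_neutral) auto
    also have "(\<Sum>i\<in>{1..k}. ?f i) = 2 * real k / real n" by simp
    finally have 1: "(?f has_sum (2 * real k / real n)) {1..}" .
    have 2: "((\<lambda>i. C * ?w i) has_sum (C * S)) {1..}"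
      unfolding S_def using smooth by (intro has_sum_cmult_right has_sum_infsum)
    have "(b has_sum (2 * real k / real n + C * S)) {1..}"
      unfolding b_def by (rule has_sum_add[OF 1 2])
    then show "b summable_on {1..}" "(\<Sum>\<^sub>\<infinity>i\<in>{1..}. b i) = 2 * real k / real n + C * S"
      by (auto simp: has_sum_imp_summable infsumI)
  qed
  have risk: "(if i \<le> k then (post_sd i)\<^sup>2 + (shrinkage i)\<^sup>2 / real n + (1 - shrinkage i)\<^sup>2 * (\<theta>\<^sub>0 i)\<^sup>2
      else (\<theta>\<^sub>0 i)\<^sup>2) \<le> b i" if i: "i \<ge> 1" for i
  proof (cases "i \<le> k")
    case True
    have si: "s i > 0" using s_pos i True by simp
    have "(\<theta>\<^sub>0 i)\<^sup>2 / (real n * (s i)\<^sup>2) = (1 / (real n * ((s i)\<^sup>2 * real i powr (2 * \<alpha>)))) * ?w i"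
      using i by (simp add: field_simps)
    also have "\<dots> \<le> (1 / (real n * m)) * ?w i"
      using m(2)[OF i True] m(1) n si i by (intro mult_right_mono divide_left_mono mult_left_mono mult_pos_pos) auto
    also have "\<dots> \<le> C * ?w i"
      by (intro mult_right_mono) (auto simp: C_def)
    finally show ?thesis
      using mean_coordinate_risk_le[OF i True, of "(\<theta>\<^sub>0 i)\<^sup>2"] True by (simp add: b_def)
  next
    case False
    have "1 = real k powr (-2 * \<alpha>) * real k powr (2 * \<alpha>)"
      using k by (simp add: powr_add[symmetric])
    also have "\<dots> \<le> real k powr (-2 * \<alpha>) * real i powr (2 * \<alpha>)"
      using False \<alpha> by (intro mult_left_mono powr_mono2) auto
    also have "\<dots> \<le> C * real i powr (2 * \<alpha>)"
      using n m by (intro mult_right_mono) (auto simp: C_def)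
    finally have "1 * (\<theta>\<^sub>0 i)\<^sup>2 \<le> C * real i powr (2 * \<alpha>) * (\<theta>\<^sub>0 i)\<^sup>2"
      by (intro mult_right_mono) auto
    then show ?thesis using False by (simp add: b_def ac_simps)
  qed
  have ae: "AE x in ?P. emeasure (K x) ?B = emeasure (gaussian_posterior x) ?B"
    by (rule AE_posterior_eq_gaussian[OF post \<theta>\<^sub>0 B])
  have "(\<integral>\<^sup>+x. emeasure (K x) ?B \<partial>?P) = (\<integral>\<^sup>+x. emeasure (gaussian_posterior x) ?B \<partial>?P)"
    by (intro nn_integral_cong_AE ae)
  also have "\<dots> \<le> (\<integral>\<^sup>+x. ennreal (1 / r\<^sup>2) * (\<Sum>i. ennreal (coordinate_risk \<theta>\<^sub>0 (Suc i) (x (Suc i)))) \<partial>?P)"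
    by (intro nn_integral_mono emeasure_gaussian_posterior_le \<theta>\<^sub>0 r)
  also have "\<dots> = ennreal (1 / r\<^sup>2) * (\<Sum>i. \<integral>\<^sup>+x. ennreal (coordinate_risk \<theta>\<^sub>0 (Suc i) (x (Suc i))) \<partial>?P)"
    by (subst nn_integral_cmult) (simp_all add: nn_integral_suminf)
  also have "\<dots> \<le> ennreal (1 / r\<^sup>2) * (\<Sum>i. ennreal (b (Suc i)))"
    by (subst nn_integral_coordinate_risk, simp)
       (intro mult_left_mono suminf_le ennreal_leI risk summableI, auto)
  also have "(\<Sum>i. ennreal (b (Suc i))) = ennreal (2 * real k / real n + C * S)"
    using ennreal_infsum_atLeast1[OF b summ_b] sum_b by simp
  also have "ennreal (1 / r\<^sup>2) * \<dots> = ennreal ?bound"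
    using C S by (subst ennreal_mult[symmetric]) (auto simp: C_def S_def)
  finally have main: "(\<integral>\<^sup>+x. emeasure (K x) ?B \<partial>?P) \<le> ennreal ?bound" .
  have bound_nn: "?bound \<ge> 0"
    using C S unfolding C_def[symmetric] S_def[symmetric] by (intro divide_nonneg_nonneg add_nonneg_nonneg) auto
  have "(\<integral>x. measure (K x) {\<theta> \<in> space (K x). ell2_norm (\<lambda>i. \<theta> i - \<theta>\<^sub>0 i) \<ge> r} \<partial>?P) = (\<integral>x. measure (K x) ?B \<partial>?P)"
    by (intro Bochner_Integration.integral_cong refl) (simp add: spK)
  also have "\<dots> = enn2real (\<integral>\<^sup>+x. ennreal (measure (K x) ?B) \<partial>?P)"
    using Km by (intro integral_eq_nn_integral) (auto cong: measurable_cong_sets)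
  also have "(\<integral>\<^sup>+x. ennreal (measure (K x) ?B) \<partial>?P) = (\<integral>\<^sup>+x. emeasure (K x) ?B \<partial>?P)"
    by (intro nn_integral_cong) (auto simp: finite_measure.emeasure_eq_measure prob_space.finite_measure spK)
  also have "enn2real \<dots> \<le> ?bound"
    using main bound_nn by (rule enn2real_leI[rotated])
  finally show ?thesis .
qed

end

lemma ell2_of_smooth:
  assumes \<alpha>: "\<alpha> > 0" and smooth: "(\<lambda>i. (\<theta> i)\<^sup>2 * real i powr (2 * \<alpha>)) summable_on {1..}"
  shows "\<theta> \<in> ell2"
  unfolding ell2_def mem_Collect_eq
proof (rule summable_on_comparison_test[OF smooth])
  fix i :: nat assume "i \<in> {1..}"
  then have "1 \<le> real i powr (2 * \<alpha>)" using \<alpha> by (intro ge_one_powr_ge_zero) auto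
  then show "(\<theta> i)\<^sup>2 \<le> (\<theta> i)\<^sup>2 * real i powr (2 * \<alpha>)"
    using mult_left_mono[of 1 "real i powr (2 * \<alpha>)" "(\<theta> i)\<^sup>2"] by simp
qed simp

theorem theorem11:
  fixes \<alpha> :: real
    and k :: "nat \<Rightarrow> nat"
    and \<sigma> :: "nat \<Rightarrow> nat \<Rightarrow> real"
    and \<theta>\<^sub>0 :: "nat \<Rightarrow> real"
    and K :: "nat \<Rightarrow> (nat \<Rightarrow> real) \<Rightarrow> (nat \<Rightarrow> real) measure"
  assumes "\<alpha> > 0"
    and "\<And>j i. 1 \<le> i \<Longrightarrow> i \<le> j \<Longrightarrow> \<sigma> i j > 0"
    and "(\<lambda>n. real (k n)) \<in> \<Theta>(\<lambda>n. real n powr (1 / (2 * \<alpha> + 1)))"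
    and "(\<lambda>n. Min ((\<lambda>i. (\<sigma> i (k n))\<^sup>2 * real i powr (2 * \<alpha>)) ` {1..k n}))
           \<in> \<Theta>(\<lambda>n. 1 / real (k n))"
    and "\<And>n. n \<ge> 1 \<Longrightarrow>
           is_posterior (truncated_gaussian_prior (k n) (\<lambda>i. \<sigma> i (k n)))
             (white_noise n) seq_space (K n)"
    and "(\<lambda>i. (\<theta>\<^sub>0 i)\<^sup>2 * real i powr (2 * \<alpha>)) summable_on {1..}"
  shows "posterior_converges_at_rate K \<theta>\<^sub>0 (\<lambda>n. real n powr (- \<alpha> / (2 * \<alpha> + 1)))"
  unfolding posterior_converges_at_rate_def
proof (intro allI impI)
  fix M :: "nat \<Rightarrow> real" assume M: "filterlim M at_top sequentially"
  define p where "p = 1 / (2 * \<alpha> + 1)"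
  define S where "S = (\<Sum>\<^sub>\<infinity>i\<in>{1..}. (\<theta>\<^sub>0 i)\<^sup>2 * real i powr (2 * \<alpha>))"
  let ?m = "\<lambda>n. Min ((\<lambda>i. (\<sigma> i (k n))\<^sup>2 * real i powr (2 * \<alpha>)) ` {1..k n})"
  let ?\<epsilon> = "\<lambda>n. real n powr (- \<alpha> / (2 * \<alpha> + 1))"
  let ?I = "\<lambda>n. \<integral>x. measure (K n x) {\<theta> \<in> space (K n x). ell2_norm (\<lambda>i. \<theta> i - \<theta>\<^sub>0 i) \<ge> M n * ?\<epsilon> n} \<partial>white_noise n \<theta>\<^sub>0"
  have S: "S \<ge> 0" unfolding S_def by (intro infsum_nonneg) simp
  have \<theta>\<^sub>0: "\<theta>\<^sub>0 \<in> ell2" by (rule ell2_of_smooth[OF assms(1,6)])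
  have k_theta: "(\<lambda>n. real (k n)) \<in> \<Theta>(\<lambda>n. real n powr p)"
    unfolding p_def by (rule assms(3))
  obtain c1 where c1: "c1 > 0" "eventually (\<lambda>n. norm (real (k n)) \<ge> c1 * norm (real n powr p)) sequentially"
    by (rule landau_omega.bigE[OF bigthetaD2[OF k_theta]])
  obtain c2 where c2: "c2 > 0" "eventually (\<lambda>n. norm (real (k n)) \<le> c2 * norm (real n powr p)) sequentially"
    by (rule landau_o.bigE[OF bigthetaD1[OF k_theta]])
  obtain c3 where c3: "c3 > 0" "eventually (\<lambda>n. norm (?m n) \<ge> c3 * norm (1 / real (k n))) sequentially"
    by (rule landau_omega.bigE[OF bigthetaD2[OF assms(4)]])
  define C where "C = 2 * c2 + (c2 / c3 + c1 powr (-2 * \<alpha>)) * S"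
  have bound: "eventually (\<lambda>n. norm (?I n) \<le> C / (M n)\<^sup>2) sequentially"
    using c1(2) c2(2) c3(2) eventually_ge_at_top[of 1] filterlim_at_top_dense[THEN iffD1, OF M, rule_format, of 0]
  proof eventually_elim
    fix n :: nat
    assume k1: "norm (real (k n)) \<ge> c1 * norm (real n powr p)"
      and k2: "norm (real (k n)) \<le> c2 * norm (real n powr p)"
      and m3: "norm (?m n) \<ge> c3 * norm (1 / real (k n))"
      and n: "n \<ge> 1" and Mn: "M n > 0"
    interpret truncated_gaussian "k n" n "\<lambda>i. \<sigma> i (k n)"
      by unfold_locales (use assms(2) n in auto)
    define q where "q = real n powr (-2 * \<alpha> * p)"
    have npos: "real n > 0" using n by simp
    have q: "q > 0" using npos by (simp add: q_def)
    have "0 < c1 * real n powr p" using c1(1) npos by simp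
    also have "\<dots> \<le> real (k n)" using k1 by simp
    finally have kp: "real (k n) > 0" .
    then have kn: "k n \<ge> 1" by simp
    have p: "(2 * \<alpha> + 1) * p = 1" using assms(1) by (simp add: p_def)
    have np_n: "real n powr p = real n * q"
    proof -
      have "p = 1 + (-2 * \<alpha> * p)" using p by (simp add: algebra_simps)
      then have "real n powr p = real n powr (1 + (-2 * \<alpha> * p))" by (rule arg_cong)
      also have "\<dots> = real n * q" using npos by (simp only: powr_add q_def) simp
      finally show ?thesis .
    qed
    have eps2: "(M n * ?\<epsilon> n)\<^sup>2 = (M n)\<^sup>2 * q"
    proof -
      have "(?\<epsilon> n)\<^sup>2 = q"
        unfolding q_def p_def power2_eq_square powr_add[symmetric] by (simp add: field_simps)
      then show ?thesis by (simp add: power_mult_distrib)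
    qed
    have "(\<sigma> i (k n))\<^sup>2 * real i powr (2 * \<alpha>) > 0" if "1 \<le> i" "i \<le> k n" for i
      using assms(2)[OF that] that by (intro mult_pos_pos) simp_all
    then have mpos: "?m n > 0" using kn by (subst Min_gr_iff) auto
    have m_ge: "c3 / real (k n) \<le> ?m n" using m3 mpos kp by simp
    have I: "?I n \<le> (2 * real (k n) / real n + (1 / (real n * ?m n) + real (k n) powr (-2 * \<alpha>)) * S) / (M n * ?\<epsilon> n)\<^sup>2"
      unfolding S_def
    proof (rule expected_posterior_mass_le[OF assms(5)[OF n] \<theta>\<^sub>0 _ assms(6,1) kn mpos])
      show "M n * ?\<epsilon> n > 0" using Mn npos by simp
      show "?m n \<le> (\<sigma> i (k n))\<^sup>2 * real i powr (2 * \<alpha>)" if "1 \<le> i" "i \<le> k n" for i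
        using that by (intro Min_le) auto
    qed
    have k2': "real (k n) \<le> c2 * (real n * q)"
      using k2 q unfolding np_n by (simp add: abs_mult)
    have b1: "2 * real (k n) / real n \<le> 2 * c2 * q"
      using k2' npos by (simp add: field_simps)
    have b2: "1 / (real n * ?m n) \<le> c2 / c3 * q"
    proof -
      have "1 / (real n * ?m n) \<le> 1 / (real n * (c3 / real (k n)))"
        using m_ge npos kp c3(1) mpos by (intro divide_left_mono mult_left_mono mult_pos_pos) auto
      also have "\<dots> = real (k n) / (real n * c3)" by simp
      also have "\<dots> \<le> (c2 * (real n * q)) / (real n * c3)"
        using k2' npos c3(1) by (intro divide_right_mono) auto
      also have "\<dots> = c2 / c3 * q" using npos by simp
      finally show ?thesis .
    qed
    have b3: "real (k n) powr (-2 * \<alpha>) \<le> c1 powr (-2 * \<alpha>) * q"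
    proof -
      have "real (k n) powr (-2 * \<alpha>) \<le> (c1 * real n powr p) powr (-2 * \<alpha>)"
        using k1 c1(1) npos assms(1) by (intro powr_mono2') auto
      also have "\<dots> = c1 powr (-2 * \<alpha>) * q"
        using c1(1) by (simp add: powr_mult powr_powr q_def mult.commute)
      finally show ?thesis .
    qed
    have "2 * real (k n) / real n + (1 / (real n * ?m n) + real (k n) powr (-2 * \<alpha>)) * S \<le>
        2 * c2 * q + (c2 / c3 * q + c1 powr (-2 * \<alpha>) * q) * S"
      using b1 b2 b3 S by (intro add_mono mult_right_mono) auto
    also have "\<dots> = C * q" by (simp add: C_def algebra_simps)
    finally have "?I n \<le> C * q / (M n * ?\<epsilon> n)\<^sup>2"
      by (intro order.trans[OF I] divide_right_mono) auto
    also have "\<dots> = C / (M n)\<^sup>2" unfolding eps2 using q by simp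
    finally show "norm (?I n) \<le> C / (M n)\<^sup>2"
      by (simp add: abs_of_nonneg Bochner_Integration.integral_nonneg)
  qed
  have "(\<lambda>n. C / (M n)\<^sup>2) \<longlonglongrightarrow> 0"
    by (intro real_tendsto_divide_at_top[OF tendsto_const] filterlim_pow_at_top M) simp
  then show "?I \<longlonglongrightarrow> 0"
    by (rule Lim_null_comparison[OF bound])
qed

end
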